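(* Let $U_0$ be an admissible initial condition and let $(U(t,x),L_t)$ denote the classical solution of the free boundary problem (FBP) with initial condition $U_0$. Define $$r_0=\sup\Big(\{0\}\cup\Big\{r\in(0,\sqrt2):\int_0^\infty e^{rx}U_0(x)\,dx<\infty\Big\}\Big).$$ Then $$\limsup_{t\to\infty}\frac1tL_t=\begin{cases}\frac1{r_0}+\frac{r_0}2&\text{if }r_0>0,\\ \infty&\text{if }r_0=0.\end{cases}$$
   Context: Admissible initial condition: a càdlàg non-increasing function $U_0:\mathbb R\to[0,1]$ with $U_0(x)\to 1$ as $x\to-\infty$ and $U_0(x)\to 0$ as $x\to\infty$. (FBP): $\partial_t U=\frac12\Delta U+U$ for $t>0$, $x>L_t$; $U(t,x)=1$ for $t>0$, $x\le L_t$; $\partial_xU(t,L_t)=0$ for $t>0$; $U(t,\cdot)\to U_0(\cdot)$ in $L^1_{\mathrm{loc}}$ as $t\to0$. A classical solution is a pair $(U(t,x),L_t)$ such that: (i) $L_t\in\mathbb R$ for all $t>0$ and $t\mapsto L_t$ is continuous on $(0,\infty)$; (ii) $U:(0,\infty)\times\mathbb R\to[0,1]$ with $U\in C^{1,2}(\{(t,x):t>0,x>L_t\})\cap C((0,\infty)\times\mathbb R)$; (iii) $(U,L)$ satisfies (FBP). For every admissible $U_0$ a classical solution exists and is unique (known). *)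

theory Defs
  imports "HOL-Analysis.Analysis"
begin

definition cadlag :: "(real \<Rightarrow> real) \<Rightarrow> bool" where
  "cadlag f \<longleftrightarrow>
     (\<forall>x. (f \<longlongrightarrow> f x) (at_right x) \<and> (\<exists>l. (f \<longlongrightarrow> l) (at_left x)))"

definition admissible :: "(real \<Rightarrow> real) \<Rightarrow> bool" where
  "admissible U\<^sub>0 \<longleftrightarrow>
     cadlag U\<^sub>0 \<and> antimono U\<^sub>0 \<and> range U\<^sub>0 \<subseteq> {0..1} \<and>
     (U\<^sub>0 \<longlongrightarrow> 1) at_bot \<and> (U\<^sub>0 \<longlongrightarrow> 0) at_top"

text \<open>Functions of time and space are curried, \<open>U t x\<close>. Values at times \<open>t \<le> 0\<close> are
  never constrained.\<close>

definition dt :: "(real \<Rightarrow> real \<Rightarrow> real) \<Rightarrow> real \<Rightarrow> real \<Rightarrow> real" where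
  "dt U t x = deriv (\<lambda>s. U s x) t"

definition dx :: "(real \<Rightarrow> real \<Rightarrow> real) \<Rightarrow> real \<Rightarrow> real \<Rightarrow> real" where
  "dx U t x = deriv (\<lambda>y. U t y) x"

definition dxx :: "(real \<Rightarrow> real \<Rightarrow> real) \<Rightarrow> real \<Rightarrow> real \<Rightarrow> real" where
  "dxx U = dx (dx U)"

text \<open>The class \<open>C\<^sup>1\<^sup>,\<^sup>2\<close>: once in \<open>t\<close>, twice in \<open>x\<close>. It is used for open sets \<open>\<Omega>\<close> only.\<close>

definition C12_on :: "(real \<times> real) set \<Rightarrow> (real \<Rightarrow> real \<Rightarrow> real) \<Rightarrow> bool" where
  "C12_on \<Omega> U \<longleftrightarrow>
     (\<forall>(t, x)\<in>\<Omega>. (\<lambda>s. U s x) field_differentiable at t \<and>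
                 (\<lambda>y. U t y) field_differentiable at x \<and>
                 (\<lambda>y. dx U t y) field_differentiable at x) \<and>
     continuous_on \<Omega> (\<lambda>(t, x). U t x) \<and>
     continuous_on \<Omega> (\<lambda>(t, x). dt U t x) \<and>
     continuous_on \<Omega> (\<lambda>(t, x). dx U t x) \<and>
     continuous_on \<Omega> (\<lambda>(t, x). dxx U t x)"

definition tendsto_L1_loc ::
  "('a \<Rightarrow> real \<Rightarrow> real) \<Rightarrow> (real \<Rightarrow> real) \<Rightarrow> 'a filter \<Rightarrow> bool" where
  "tendsto_L1_loc f g F \<longleftrightarrow>
     (\<forall>K. compact K \<longrightarrow>
        ((\<lambda>t. \<integral>\<^sup>+x\<in>K. ennreal \<bar>f t x - g x\<bar> \<partial>lborel) \<longlongrightarrow> 0) F)"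

text \<open>The condition at the boundary point \<open>L t\<close> is a two-sided derivative. Since \<open>U t\<close> is
  constant to the left of \<open>L t\<close>, this is the same as the right derivative being \<open>0\<close>.\<close>

definition FBP ::
  "(real \<Rightarrow> real) \<Rightarrow> (real \<Rightarrow> real \<Rightarrow> real) \<Rightarrow> (real \<Rightarrow> real) \<Rightarrow> bool" where
  "FBP U\<^sub>0 U L \<longleftrightarrow>
     (\<forall>t>0. \<forall>x>L t. dt U t x = 1/2 * dxx U t x + U t x) \<and>
     (\<forall>t>0. \<forall>x\<le>L t. U t x = 1) \<and>
     (\<forall>t>0. ((\<lambda>x. U t x) has_real_derivative 0) (at (L t))) \<and>
     tendsto_L1_loc U U\<^sub>0 (at_right 0)"

definition classical_solution ::
  "(real \<Rightarrow> real) \<Rightarrow> (real \<Rightarrow> real \<Rightarrow> real) \<Rightarrow> (real \<Rightarrow> real) \<Rightarrow> bool" where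
  "classical_solution U\<^sub>0 U L \<longleftrightarrow>
     continuous_on {0<..} L \<and>
     (\<forall>t>0. \<forall>x. U t x \<in> {0..1}) \<and>
     C12_on {(t, x). t > 0 \<and> x > L t} U \<and>
     continuous_on ({0<..} \<times> UNIV) (\<lambda>(t, x). U t x) \<and>
     FBP U\<^sub>0 U L"

definition decay_rate :: "(real \<Rightarrow> real) \<Rightarrow> real" where
  "decay_rate U\<^sub>0 =
     Sup ({0} \<union> {r. 0 < r \<and> r < sqrt 2 \<and>
                    (\<integral>\<^sup>+x\<in>{0..}. ennreal (exp (r * x) * U\<^sub>0 x) \<partial>lborel) < \<infinity>})"

end

(*
  Upper bound. Classical solutions satisfy a comparison principle with strict supersolutions S: at a
  first contact point on the free boundary, S has increased in time, so the boundary was strictly to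
  the left just before; Hopf's lemma then makes the derivative of S - U at the contact point
  positive, although both S and U are flat there. Comparison with
  B exp (- r (x - c t)), c = 1/r + r/2, gives L t <= c t + const whenever U0 x <= B exp (- r x).

  Lower bound (Kaplan's method). The integral of U against a bump exp (v y) sin (pi y / w) moving at
  speed v < sqrt 2 ahead of the free boundary grows like exp (mu t) with mu close to 1 - v^2/2, but
  it stays bounded because U <= 1. If L t <= A + c t with c = 1/r + r/2, a bump of speed r starting at
  a > A is free to grow up to time (a - A)/(c - r), and (1 - r^2/2)/(c - r) = r, which forces U0 to
  decay almost like exp (- r x). If L moves at a speed below sqrt 2, a bump can grow forever.
*)
theory Submission
  imports Defs
begin

text \<open>The obstacle in the upper bound is the start: \<open>U\<^sub>0\<close> is attained only
  in local L1, so nothing can be compared pointwise at time 0. Comparison begins at a small time,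
  when the excess of \<open>U\<close> over the exponential has small integral on a compact interval
  but need not be small. A sum of heat kernels dominates this excess and has become small at the
  time of interest. One more term, growing in space, supplies strictness and keeps the supersolution
  above 1 far to the right.

  The lower bound concerns a limsup because a bump must outrun the boundary at all times, and a
  limsup below a given speed yields one line above \<open>L\<close> for all times.

  Monotonicity of \<open>U\<^sub>0\<close> makes exponential moments and pointwise exponential decay
  equivalent up to an arbitrarily small loss in the exponent. The speed \<open>1 / r + r / 2\<close>
  decreases on \<open>(0, sqrt 2]\<close> to the value \<open>sqrt 2\<close>, and
  \<open>1 - v\<^sup>2 / 2\<close> changes sign at this same speed. Hence the bump that grows
  forever takes over exactly when \<open>r\<^sub>0 = sqrt 2\<close>.\<close>

section \<open>Derivative tests at one-sided and two-sided minima\<close>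

lemma left_second_derivative_nonneg:
  fixes f f' :: "real \<Rightarrow> real"
  assumes "d > 0"
    and f: "\<And>y. x - d < y \<Longrightarrow> y \<le> x \<Longrightarrow> (f has_real_derivative f' y) (at y)"
    and "f' x = 0" and f2: "(f' has_real_derivative f2) (at x)"
    and ge: "\<And>y. x - d < y \<Longrightarrow> y \<le> x \<Longrightarrow> f x \<le> f y"
  shows "0 \<le> f2"
proof (rule ccontr)
  assume "\<not> 0 \<le> f2"
  then obtain e where e: "e > 0" "\<And>h. h > 0 \<Longrightarrow> h < e \<Longrightarrow> f' x < f' (x - h)"
    using DERIV_neg_dec_left[OF f2] by auto
  define h where "h = min d e / 2"
  have h: "h > 0" "h < d" "h < e" using \<open>d > 0\<close> \<open>e > 0\<close> by (auto simp: h_def)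
  obtain z where z: "x - h < z" "z < x" "f x - f (x - h) = (x - (x - h)) * f' z"
    using MVT2[of "x - h" x f f'] f h by (smt (verit))
  have "f' z > 0" using e(2)[of "x - z"] z h \<open>f' x = 0\<close> by auto
  then have "f x - f (x - h) > 0" using z h by simp
  with ge[of "x - h"] h show False by auto
qed

lemma left_derivative_nonpos:
  fixes f :: "real \<Rightarrow> real"
  assumes "(f has_real_derivative D) (at t)" and "d > 0"
    and "\<And>s. t - d < s \<Longrightarrow> s < t \<Longrightarrow> f t \<le> f s"
  shows "D \<le> 0"
proof (rule ccontr)
  assume "\<not> D \<le> 0"
  then obtain e where e: "e > 0" "\<And>h. h > 0 \<Longrightarrow> h < e \<Longrightarrow> f (t - h) < f t"
    using DERIV_pos_inc_left[OF assms(1)] by auto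
  define h where "h = min d e / 2"
  have h: "h > 0" "h < d" "h < e" using \<open>d > 0\<close> \<open>e > 0\<close> by (auto simp: h_def)
  show False using e(2)[of h] assms(3)[of "t - h"] h by auto
qed

lemma second_derivative_nonneg:
  fixes f f' :: "real \<Rightarrow> real"
  assumes "d > 0"
    and f: "\<And>y. \<bar>y - x\<bar> < d \<Longrightarrow> (f has_real_derivative f' y) (at y)"
    and f2: "(f' has_real_derivative f2) (at x)"
    and ge: "\<And>y. \<bar>y - x\<bar> < d \<Longrightarrow> f x \<le> f y"
  shows "0 \<le> f2"
proof -
  have "f' x = 0"
    using DERIV_local_min[OF f, of x d] ge \<open>d > 0\<close> by (simp add: abs_minus_commute)
  then show ?thesis
    using left_second_derivative_nonneg[of d x f f' f2] assms by auto
qed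

section \<open>Local regularity of a classical solution and of its boundary\<close>

locale fbp_solution =
  fixes U\<^sub>0 :: "real \<Rightarrow> real" and U :: "real \<Rightarrow> real \<Rightarrow> real" and L :: "real \<Rightarrow> real"
  assumes sol: "classical_solution U\<^sub>0 U L"
begin

lemma L_cont: "continuous_on {0<..} L"
  and U_range: "t > 0 \<Longrightarrow> 0 \<le> U t x" "t > 0 \<Longrightarrow> U t x \<le> 1"
  and U_C12: "C12_on {(t, x). t > 0 \<and> x > L t} U"
  and U_cont: "continuous_on ({0<..} \<times> UNIV) (\<lambda>(t, x). U t x)"
  and U_pde: "t > 0 \<Longrightarrow> x > L t \<Longrightarrow> dt U t x = 1/2 * dxx U t x + U t x"
  and U_left: "t > 0 \<Longrightarrow> x \<le> L t \<Longrightarrow> U t x = 1"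
  and U_flat: "t > 0 \<Longrightarrow> ((\<lambda>x. U t x) has_real_derivative 0) (at (L t))"
  and U_init: "tendsto_L1_loc U U\<^sub>0 (at_right 0)"
  using sol unfolding classical_solution_def FBP_def by auto

lemma U_dt: "t > 0 \<Longrightarrow> x > L t \<Longrightarrow> ((\<lambda>s. U s x) has_real_derivative dt U t x) (at t)"
  and U_dx: "t > 0 \<Longrightarrow> x > L t \<Longrightarrow> ((\<lambda>y. U t y) has_real_derivative dx U t x) (at x)"
  and U_dxx: "t > 0 \<Longrightarrow> x > L t \<Longrightarrow> ((\<lambda>y. dx U t y) has_real_derivative dxx U t x) (at x)"
proof -
  assume "t > 0" "x > L t"
  then have "(\<lambda>s. U s x) field_differentiable at t" "(\<lambda>y. U t y) field_differentiable at x"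
    "(\<lambda>y. dx U t y) field_differentiable at x"
    using U_C12 unfolding C12_on_def by auto
  then show "((\<lambda>s. U s x) has_real_derivative dt U t x) (at t)"
    "((\<lambda>y. U t y) has_real_derivative dx U t x) (at x)"
    "((\<lambda>y. dx U t y) has_real_derivative dxx U t x) (at x)"
    unfolding dt_def dxx_def dx_def[of U t x] dx_def[of "dx U" t x]
    by (auto intro: field_differentiable_derivI)
qed

lemma U_slice_cont: "t > 0 \<Longrightarrow> continuous_on A (U t)"
  using continuous_on_compose2[OF U_cont continuous_on_Pair[OF continuous_on_const[of A t] continuous_on_id[of A]]]
  by auto

lemma L_eventually_less:
  assumes "t > 0" "L t < x"
  shows "\<exists>d>0. d < t \<and> (\<forall>s. \<bar>s - t\<bar> < d \<longrightarrow> L s < x)"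
proof -
  have "isCont L t" using L_cont \<open>t > 0\<close>
    by (simp add: continuous_on_eq_continuous_at)
  then have "\<forall>\<^sub>F s in at t. L s < x" using \<open>L t < x\<close>
    by (simp add: isCont_def order_tendstoD(2))
  then obtain d where "d > 0" and d: "\<And>s. s \<noteq> t \<Longrightarrow> dist s t < d \<Longrightarrow> L s < x"
    unfolding eventually_at by auto
  have "L s < x" if "\<bar>s - t\<bar> < min d (t/2)" for s
    using that assms d[of s] by (cases "s = t") (auto simp: dist_real_def)
  then show ?thesis using assms \<open>d > 0\<close>
    by (intro exI[of _ "min d (t/2)"]) auto
qed

lemma L_eventually_greater:
  assumes "t > 0" "x < L t"
  shows "\<exists>d>0. d < t \<and> (\<forall>s. \<bar>s - t\<bar> < d \<longrightarrow> x < L s)"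
proof -
  have "isCont L t" using L_cont \<open>t > 0\<close>
    by (simp add: continuous_on_eq_continuous_at)
  then have "\<forall>\<^sub>F s in at t. x < L s" using \<open>x < L t\<close>
    by (simp add: isCont_def order_tendstoD(1))
  then obtain d where "d > 0" and d: "\<And>s. s \<noteq> t \<Longrightarrow> dist s t < d \<Longrightarrow> x < L s"
    unfolding eventually_at by auto
  have "x < L s" if "\<bar>s - t\<bar> < min d (t/2)" for s
    using that assms d[of s] by (cases "s = t") (auto simp: dist_real_def)
  then show ?thesis using assms \<open>d > 0\<close>
    by (intro exI[of _ "min d (t/2)"]) auto
qed

section \<open>Comparison with strict supersolutions\<close>

text \<open>By \<open>lat\<close> every contact lies in \<open>{-R..R}\<close>, so compactness gives
  a first one. The inequality \<open>strict\<close> is imposed also where \<open>U = 1\<close>: at a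
  contact left of the boundary \<open>S\<close> would have a spatial minimum of value 1 and a
  nonpositive time derivative, a contradiction. It reaches to \<open>R + 1\<close> because the Hopf
  rectangle attached to a contact point has unit width.\<close>

lemma comparison:
  fixes S St Sx Sxx :: "real \<Rightarrow> real \<Rightarrow> real"
  assumes "0 < \<tau>" "0 < \<kappa>"
    and S_dt: "\<And>t x. \<tau> \<le> t \<Longrightarrow> t \<le> T \<Longrightarrow> ((\<lambda>s. S s x) has_real_derivative St t x) (at t)"
    and S_dx: "\<And>t x. \<tau> \<le> t \<Longrightarrow> t \<le> T \<Longrightarrow> (S t has_real_derivative Sx t x) (at x)"
    and S_dxx: "\<And>t x. \<tau> \<le> t \<Longrightarrow> t \<le> T \<Longrightarrow> (Sx t has_real_derivative Sxx t x) (at x)"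
    and S_cont: "continuous_on ({\<tau>..T} \<times> UNIV) (\<lambda>(t, x). S t x)"
    and strict: "\<And>t x. \<tau> \<le> t \<Longrightarrow> t \<le> T \<Longrightarrow> \<bar>x\<bar> \<le> R + 1 \<Longrightarrow>
                   1/2 * Sxx t x + S t x + \<kappa> \<le> St t x"
    and init: "\<And>x. U \<tau> x < S \<tau> x"
    and lat: "\<And>t x. \<tau> \<le> t \<Longrightarrow> t \<le> T \<Longrightarrow> R < \<bar>x\<bar> \<Longrightarrow> 1 < S t x"
    and "\<tau> \<le> t\<^sub>1" "t\<^sub>1 \<le> T"
  shows "U t\<^sub>1 x\<^sub>1 < S t\<^sub>1 x\<^sub>1"
proof (rule ccontr)
  assume contra: "\<not> U t\<^sub>1 x\<^sub>1 < S t\<^sub>1 x\<^sub>1"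
  have W_cont: "continuous_on ({\<tau>..T} \<times> UNIV) (\<lambda>z. S (fst z) (snd z) - U (fst z) (snd z))"
  proof -
    have "continuous_on ({\<tau>..T} \<times> UNIV) (\<lambda>(t, x). U t x)"
      using \<open>0 < \<tau>\<close> by (intro continuous_on_subset[OF U_cont]) auto
    with S_cont show ?thesis by (auto simp: case_prod_unfold intro!: continuous_intros)
  qed
  define D where "D = {z \<in> {\<tau>..T} \<times> {-R..R}. S (fst z) (snd z) - U (fst z) (snd z) \<le> 0}"
  have "compact D"
  proof -
    have "closed D" unfolding D_def
      by (intro continuous_on_closed_Collect_le closed_Times continuous_on_const
          continuous_on_subset[OF W_cont]) auto
    moreover have "D \<subseteq> {\<tau>..T} \<times> {-R..R}" by (auto simp: D_def)
    ultimately show ?thesis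
      by (metis compact_Icc compact_Times compact_Int_closed inf.absorb_iff2)
  qed
  have outside: "U t x < S t x" if "\<tau> \<le> t" "t \<le> T" "R < \<bar>x\<bar>" for t x
    using lat[OF that] U_range(2)[of t x] that \<open>0 < \<tau>\<close> by auto
  have "(t\<^sub>1, x\<^sub>1) \<in> D"
    using contra outside[of t\<^sub>1 x\<^sub>1] \<open>\<tau> \<le> t\<^sub>1\<close> \<open>t\<^sub>1 \<le> T\<close> by (force simp: D_def)
  then obtain t x where D: "(t, x) \<in> D" and min: "\<And>z. z \<in> D \<Longrightarrow> t \<le> fst z"
    using continuous_attains_inf[OF \<open>compact D\<close>, of fst] continuous_on_fst[OF continuous_on_id]
    by fastforce
  have t: "\<tau> \<le> t" "t \<le> T" and x: "\<bar>x\<bar> \<le> R" and "S t x \<le> U t x" using D by (auto simp: D_def)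
  with init[of x] have "\<tau> < t" by (cases "\<tau> = t") auto
  have "t > 0" using \<open>0 < \<tau>\<close> t by simp
  have before: "U s y < S s y" if "\<tau> \<le> s" "s < t" for s y
    using min[of "(s, y)"] outside[of s y] that t by (force simp: D_def)
  have at_t: "U t y \<le> S t y" for y
  proof -
    have "continuous_on {\<tau>..t} (\<lambda>s. (s, y))" by (intro continuous_intros)
    moreover have "(\<lambda>s. (s, y)) ` {\<tau>..t} \<subseteq> {\<tau>..T} \<times> UNIV" using t by auto
    ultimately have "continuous_on {\<tau>..t} (\<lambda>s. S s y - U s y)"
      using continuous_on_compose2[OF W_cont] by fastforce
    then have "((\<lambda>s. S s y - U s y) \<longlongrightarrow> S t y - U t y) (at_left t)"
      using \<open>\<tau> < t\<close> by (rule continuous_on_Icc_at_leftD)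
    moreover have "\<forall>\<^sub>F s in at_left t. 0 \<le> S s y - U s y"
      using \<open>\<tau> < t\<close> before by (intro eventually_at_leftI[of \<tau>]) (auto simp: less_imp_le)
    ultimately show ?thesis
      using tendsto_lowerbound[of _ _ "at_left t" 0] by force
  qed
  have contact: "S t x = U t x" using at_t[of x] \<open>S t x \<le> U t x\<close> by simp
  have R: "\<bar>x\<bar> \<le> R + 1" using x by simp
  consider "x < L t" | "x > L t" | "x = L t" by linarith
  then show False
  proof cases
    case 1
    obtain d where d: "d > 0" "\<And>s. \<bar>s - t\<bar> < d \<Longrightarrow> x < L s" "d < t"
      using L_eventually_greater[OF \<open>t > 0\<close> 1] by auto
    have one: "S t x = 1" using contact U_left \<open>t > 0\<close> 1 by simp
    have "0 \<le> Sxx t x"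
    proof (rule second_derivative_nonneg[of "L t - x"])
      show "S t x \<le> S t y" if "\<bar>y - x\<bar> < L t - x" for y
        using at_t[of y] U_left[of t y] one that \<open>t > 0\<close> by auto
    qed (use 1 S_dx S_dxx t in auto)
    moreover have "St t x \<le> 0"
    proof (rule left_derivative_nonpos[OF S_dt[OF t], of "min d (t - \<tau>)"])
      show "S t x \<le> S s x" if "t - min d (t - \<tau>) < s" "s < t" for s
      proof -
        have "\<tau> < s" "\<bar>s - t\<bar> < d" using that by auto
        then show ?thesis
          using before[of s x] U_left[of s x] d(2)[of s] one that \<open>0 < \<tau>\<close> by auto
      qed
    qed (use d \<open>\<tau> < t\<close> in auto)
    ultimately show False using strict[OF t R] one \<open>0 < \<kappa>\<close> by simp
  next
    case 2
    have "0 \<le> Sxx t x - dxx U t x"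
    proof (rule second_derivative_nonneg[of "x - L t"])
      show "((\<lambda>y. S t y - U t y) has_real_derivative (Sx t y - dx U t y)) (at y)"
        if "\<bar>y - x\<bar> < x - L t" for y
        using that by (intro DERIV_diff S_dx t U_dx \<open>t > 0\<close>) auto
      show "((\<lambda>y. Sx t y - dx U t y) has_real_derivative (Sxx t x - dxx U t x)) (at x)"
        using 2 by (intro DERIV_diff S_dxx t U_dxx \<open>t > 0\<close>)
    qed (use 2 at_t contact in auto)
    moreover have "St t x - dt U t x \<le> 0"
    proof (rule left_derivative_nonpos[of "\<lambda>s. S s x - U s x" _ t "t - \<tau>"])
      show "((\<lambda>s. S s x - U s x) has_real_derivative (St t x - dt U t x)) (at t)"
        using 2 by (intro DERIV_diff S_dt t U_dt \<open>t > 0\<close>)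
    qed (use before \<open>\<tau> < t\<close> contact in \<open>auto simp: less_imp_le\<close>)
    ultimately show False
      using strict[OF t R] U_pde[OF \<open>t > 0\<close> 2] contact \<open>0 < \<kappa>\<close> by simp
  next
    case 3
    have one: "S t x = 1" using contact U_left \<open>t > 0\<close> 3 by simp
    have Sx0: "Sx t x = 0"
    proof -
      have "((\<lambda>y. S t y - U t y) has_real_derivative (Sx t x - 0)) (at x)"
        using U_flat[OF \<open>t > 0\<close>] 3 by (intro DERIV_diff S_dx t) auto
      from DERIV_local_min[OF this, of 1] at_t contact show ?thesis by auto
    qed
    \<comment> \<open>Here \<open>U\<close> is known to equal 1 only on the left of
      \<open>x\<close>, so minimality of \<open>S t\<close> at \<open>x\<close> is one-sided; the
      vanishing slope \<open>Sx0\<close> makes up for the other side.\<close>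
    have "0 \<le> Sxx t x"
    proof (rule left_second_derivative_nonneg[of 1 x "S t" "Sx t"])
      show "S t x \<le> S t y" if "x - 1 < y" "y \<le> x" for y
        using at_t[of y] U_left[of t y] one that 3 \<open>t > 0\<close> by auto
    qed (use S_dx S_dxx t Sx0 in auto)
    then have "0 < St t x" using strict[OF t R] one \<open>0 < \<kappa>\<close> by simp
    then obtain e where e: "e > 0" "\<And>h. h > 0 \<Longrightarrow> h < e \<Longrightarrow> S (t - h) x < S t x"
      using DERIV_pos_inc_left[OF S_dt[OF t]] by auto
    define d where "d = Min {e/2, t - \<tau>, 1}"
    have d: "d > 0" "d < e" "d \<le> t - \<tau>" "d \<le> 1"
      using \<open>e > 0\<close> \<open>\<tau> < t\<close> by (auto simp: d_def min_def)
    \<comment> \<open>The free boundary was strictly to the left of \<open>x\<close> just before time \<open>t\<close>, so the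
      equation holds in the rectangle below and Hopf's boundary lemma applies at its corner.\<close>
    have L_less: "L s < x" if "t - d \<le> s" "s < t" for s
      using e(2)[of "t - s"] before[of s x] U_left[of s x] one that d t \<open>0 < \<tau>\<close> by fastforce
    \<comment> \<open>\<open>Z\<close> vanishes on the vertical sides and at the bottom of the
      rectangle and has slope \<open>k * d > 0\<close> at the corner \<open>(t, x)\<close>. Inside,
      its time derivative and minus half its second space derivative are each at most
      \<open>k\<close>, so subtracting it uses up only half of the strictness \<kappa>.\<close>
    define k where "k = \<kappa> / 4"
    define Z where "Z s y = k * (s - t + d) * ((y - x) * (x + 1 - y))" for s y
    define V where "V z = S (fst z) (snd z) - U (fst z) (snd z) - Z (fst z) (snd z)" for z
    let ?Q = "{t - d..t} \<times> {x..x+1}"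
    have "k > 0" using \<open>0 < \<kappa>\<close> by (simp add: k_def)
    have "continuous_on ?Q V" unfolding V_def Z_def
      using d t by (intro continuous_intros continuous_on_subset[OF W_cont]) auto
    moreover have "compact ?Q" "?Q \<noteq> {}" using d by (auto intro: compact_Times)
    ultimately obtain z where z: "z \<in> ?Q" "\<And>z'. z' \<in> ?Q \<Longrightarrow> V z \<le> V z'"
      using continuous_attains_inf by metis
    obtain s y where "z = (s, y)" by (cases z)
    with z have sy: "t - d \<le> s" "s \<le> t" "x \<le> y" "y \<le> x + 1"
      and Vmin: "\<And>s' y'. t - d \<le> s' \<Longrightarrow> s' \<le> t \<Longrightarrow> x \<le> y' \<Longrightarrow> y' \<le> x + 1 \<Longrightarrow> V (s, y) \<le> V (s', y')"
      by auto
    have W_nonneg: "U s' y' \<le> S s' y'" if "t - d \<le> s'" "s' \<le> t" for s' y'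
      using before[of s' y'] at_t[of y'] that d by (cases "s' = t") (auto simp: less_imp_le)
    have "0 \<le> V (s, y)"
    proof (rule ccontr)
      assume neg: "\<not> 0 \<le> V (s, y)"
      \<comment> \<open>The minimum may still lie at the top \<open>s = t\<close>. This is harmless:
        only the left time derivative is used, and at time \<open>t\<close> the boundary is at
        \<open>x < y\<close>.\<close>
      have "s \<noteq> t - d" "y \<noteq> x" "y \<noteq> x + 1"
        using neg W_nonneg[of s y] sy by (auto simp: V_def Z_def)
      then have in': "t - d < s" "x < y" "y < x + 1" using sy by auto
      have s: "\<tau> \<le> s" "s \<le> T" "s > 0" "L s < y" "\<bar>y\<bar> \<le> R + 1"
        using in' sy d t x \<open>0 < \<tau>\<close> L_less[of s] 3 by (cases "s = t"; auto)+
      have "0 \<le> Sxx s y - dxx U s y - (- 2 * k * (s - t + d))"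
      proof (rule second_derivative_nonneg[of "Min {y - x, x + 1 - y, y - L s}"])
        show "((\<lambda>y. S s y - U s y - Z s y) has_real_derivative
            (Sx s u - dx U s u - k * (s - t + d) * (2 * x + 1 - 2 * u))) (at u)"
          if "\<bar>u - y\<bar> < Min {y - x, x + 1 - y, y - L s}" for u
          unfolding Z_def using that
          by (intro DERIV_diff S_dx s U_dx) (auto intro!: derivative_eq_intros simp: algebra_simps)
        show "((\<lambda>u. Sx s u - dx U s u - k * (s - t + d) * (2 * x + 1 - 2 * u)) has_real_derivative
            (Sxx s y - dxx U s y - (- 2 * k * (s - t + d)))) (at y)"
          by (intro DERIV_diff S_dxx s U_dxx) (auto intro!: derivative_eq_intros)
        show "S s y - U s y - Z s y \<le> S s u - U s u - Z s u"
          if "\<bar>u - y\<bar> < Min {y - x, x + 1 - y, y - L s}" for u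
          using Vmin[of s u] that sy by (auto simp: V_def)
      qed (use in' s in auto)
      moreover have "St s y - dt U s y - k * ((y - x) * (x + 1 - y)) \<le> 0"
      proof (rule left_derivative_nonpos[of "\<lambda>s. S s y - U s y - Z s y" _ s "s - (t - d)"])
        show "((\<lambda>s. S s y - U s y - Z s y) has_real_derivative
            (St s y - dt U s y - k * ((y - x) * (x + 1 - y)))) (at s)"
          unfolding Z_def using s
          by (intro DERIV_diff S_dt U_dt) (auto intro!: derivative_eq_intros)
        show "S s y - U s y - Z s y \<le> S s' y - U s' y - Z s' y"
          if "s - (s - (t - d)) < s'" "s' < s" for s'
          using Vmin[of s' y] that sy by (auto simp: V_def)
      qed (use in' in auto)
      moreover have "- 2 * k * (s - t + d) = - 2 * (k * (s - t + d))" "\<kappa> = 4 * k"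
        by (simp_all add: k_def)
      moreover have "k * ((y - x) * (x + 1 - y)) \<le> k * (1 * 1)"
        using \<open>k > 0\<close> in' by (intro mult_left_mono mult_mono) auto
      moreover have "k * (s - t + d) \<le> k * 1"
        using \<open>k > 0\<close> sy d by (intro mult_left_mono) auto
      ultimately show False
        using strict[OF s(1,2,5)] U_pde[OF s(3,4)] W_nonneg[of s y] sy \<open>0 < \<kappa>\<close>
        by linarith
    qed
    then have barrier: "Z t y' \<le> S t y' - U t y'" if "x \<le> y'" "y' \<le> x + 1" for y'
      using Vmin[of t y'] that d by (simp add: V_def)
    \<comment> \<open>\<open>S t\<close> and \<open>U t\<close> are both flat at the corner, so this
      difference, which is zero there, would become negative just to the right, against
      \<open>barrier\<close>.\<close>
    have "((\<lambda>y. S t y - U t y - Z t y) has_real_derivative (Sx t x - 0 - k * d)) (at x)"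
      unfolding Z_def using U_flat[OF \<open>t > 0\<close>] 3
      by (intro DERIV_diff S_dx t) (auto intro!: derivative_eq_intros)
    moreover have "Sx t x - 0 - k * d < 0" using Sx0 \<open>k > 0\<close> d by simp
    ultimately obtain b where b: "b > 0"
      "\<And>h. h > 0 \<Longrightarrow> h < b \<Longrightarrow> S t (x + h) - U t (x + h) - Z t (x + h) < S t x - U t x - Z t x"
      using DERIV_neg_dec_right by blast
    define h where "h = min b 1 / 2"
    have "h > 0" "h < b" "h \<le> 1" using \<open>b > 0\<close> by (auto simp: h_def)
    with b(2)[of h] barrier[of "x + h"] contact show False by (simp add: Z_def)
  qed
qed

end

section \<open>Dominating a small integral by heat kernels\<close>

lemma ennreal_integral_continuous:
  fixes g :: "real \<Rightarrow> real"
  assumes "continuous_on {p..q} g" and "\<And>x. x \<in> {p..q} \<Longrightarrow> 0 \<le> g x"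
  shows "ennreal (integral {p..q} g) = (\<integral>\<^sup>+x\<in>{p..q}. ennreal (g x) \<partial>lborel)"
proof -
  let ?f = "\<lambda>x. indicator {p..q} x *\<^sub>R g x"
  have "?f \<in> borel_measurable borel"
    using assms(1) by (intro borel_measurable_continuous_on_indicator) auto
  moreover have "(?f has_integral integral {p..q} g) UNIV"
  proof -
    have "(g has_integral integral {p..q} g) {p..q}"
      using assms(1) by (intro integrable_integral integrable_continuous_real)
    then have "((\<lambda>x. if x \<in> {p..q} then g x else 0) has_integral integral {p..q} g) UNIV"
      by (simp only: has_integral_restrict_UNIV)
    then show ?thesis by (rule has_integral_eq[rotated]) (auto simp: indicator_def)
  qed
  ultimately have "integral\<^sup>N lborel ?f = integral {p..q} g"
    using assms(2) by (intro nn_integral_has_integral_lborel) (auto simp: indicator_def)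
  moreover have "integral\<^sup>N lborel ?f = (\<integral>\<^sup>+x\<in>{p..q}. ennreal (g x) \<partial>lborel)"
    by (intro nn_integral_cong) (auto simp: indicator_def)
  ultimately show ?thesis by simp
qed

text \<open>Turns an integral bound into a pointwise one by an upper Riemann sum. All plateaus share
  the half-width \<open>h\<close>, because each is later dominated by one heat kernel of width
  \<open>h\<close>; the strict \<open>g x < m i\<close> becomes the strict initial inequality of the
  comparison.\<close>

lemma finite_bump_cover:
  fixes g :: "real \<Rightarrow> real"
  assumes "p < q" and g_cont: "continuous_on {p..q} g"
    and g_nonneg: "\<And>x. x \<in> {p..q} \<Longrightarrow> 0 \<le> g x" and "\<epsilon> > 0"
  obtains n :: nat and h :: real and c m :: "nat \<Rightarrow> real"
  where "h > 0" "\<And>i. i < n \<Longrightarrow> 0 \<le> m i"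
    "\<And>x. x \<in> {p..q} \<Longrightarrow> \<exists>i<n. \<bar>x - c i\<bar> \<le> h \<and> g x < m i"
    "h * (\<Sum>i<n. m i) \<le> integral {p..q} g + \<epsilon>"
proof -
  \<comment> \<open>Each cell overshoots the integral by at most \<open>2 * e * h\<close>: one
    \<open>e\<close> for the raised height, one for the oscillation of \<open>g\<close>. The cells
    have total length \<open>q - p\<close>.\<close>
  define e where "e = \<epsilon> / (2 * (q - p))"
  have "e > 0" using assms by (simp add: e_def)
  have "uniformly_continuous_on {p..q} g"
    using g_cont by (intro compact_uniformly_continuous) auto
  then obtain \<delta> where "\<delta> > 0"
    and \<delta>: "\<And>x y. x \<in> {p..q} \<Longrightarrow> y \<in> {p..q} \<Longrightarrow> \<bar>y - x\<bar> < \<delta> \<Longrightarrow> \<bar>g y - g x\<bar> < e"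
    unfolding uniformly_continuous_on_def dist_real_def using \<open>e > 0\<close> by metis
  obtain n :: nat where n: "(q - p) / \<delta> < real n" using reals_Archimedean2 by blast
  have "0 < (q - p) / \<delta>" using \<open>p < q\<close> \<open>\<delta> > 0\<close> by simp
  then have "n > 0" using n by (cases n) auto
  define h where "h = (q - p) / real n"
  define c where "c i = p + real i * h" for i
  define m where "m i = g (c i) + e" for i
  have "h > 0" using \<open>p < q\<close> \<open>n > 0\<close> by (simp add: h_def)
  have "h < \<delta>" using n \<open>\<delta> > 0\<close> \<open>n > 0\<close> by (simp add: h_def field_simps)
  have nh: "real n * h = q - p" using \<open>n > 0\<close> by (simp add: h_def)
  have c_le: "c i \<le> q" if "i \<le> n" for i
    using mult_right_mono[of "real i" "real n" h] that nh \<open>h > 0\<close> by (simp add: c_def)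
  have c_ge: "p \<le> c i" for i using \<open>h > 0\<close> by (simp add: c_def)
  have c_Suc: "c (Suc i) = c i + h" for i by (simp add: c_def algebra_simps)
  have osc: "\<bar>g x - g (c i)\<bar> < e" if "i < n" "c i \<le> x" "x \<le> c (Suc i)" for i x
    using that c_le[of "Suc i"] c_ge[of i] c_Suc[of i] \<open>h < \<delta>\<close> \<open>h > 0\<close>
    by (intro \<delta>) auto
  have cell: "\<exists>i<k. c i \<le> x \<and> x \<le> c (Suc i)" if "k > 0" "p \<le> x" "x \<le> c k" for k x
    using that
  proof (induction k)
    case (Suc k)
    show ?case
    proof (cases "c k \<le> x")
      case False
      then have "k > 0" using Suc.prems by (cases k) (auto simp: c_def)
      then show ?thesis using Suc.IH Suc.prems False by (auto intro: less_SucI)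
    qed (use Suc.prems in auto)
  qed simp
  have sums: "h * (\<Sum>i<k. m i) \<le> integral {p..c k} g + 2 * e * h * real k" if "k \<le> n" for k
    using that
  proof (induction k)
    case (Suc k)
    have k: "c k \<le> c (Suc k)" "c (Suc k) \<le> q" "p \<le> c k"
      using c_le[of "Suc k"] Suc.prems c_ge c_Suc[of k] \<open>h > 0\<close> by auto
    have "integral {c k..c (Suc k)} (\<lambda>_. g (c k) - e) \<le> integral {c k..c (Suc k)} g"
      using osc[of k] Suc.prems k
      by (intro integral_le integrable_continuous_real continuous_on_subset[OF g_cont]) force+
    moreover have "integral {c k..c (Suc k)} (\<lambda>_. g (c k) - e) = h * (g (c k) - e)"
      using k c_Suc[of k] by simp
    moreover have "integral {p..c k} g + integral {c k..c (Suc k)} g = integral {p..c (Suc k)} g"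
      using k by (intro Henstock_Kurzweil_Integration.integral_combine integrable_continuous_real
          continuous_on_subset[OF g_cont]) auto
    ultimately show ?case using Suc by (simp add: m_def algebra_simps)
  qed (simp add: c_def)
  have "c n = q" using nh by (simp add: c_def)
  show ?thesis
  proof
    show "h > 0" by fact
    show "0 \<le> m i" if "i < n" for i
      using g_nonneg[of "c i"] c_le[of i] c_ge[of i] that \<open>e > 0\<close> by (simp add: m_def)
    show "\<exists>i<n. \<bar>x - c i\<bar> \<le> h \<and> g x < m i" if x: "x \<in> {p..q}" for x
    proof -
      obtain i where i: "i < n" "c i \<le> x" "x \<le> c (Suc i)"
        using cell[of n x] x \<open>n > 0\<close> \<open>c n = q\<close> by auto
      then show ?thesis using osc[OF i] c_Suc[of i] by (intro exI[of _ i]) (auto simp: m_def)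
    qed
    have "2 * e * h * real n = 2 * e * (q - p)" using nh by (simp flip: nh)
    also have "\<dots> = \<epsilon>" using \<open>p < q\<close> by (simp add: e_def field_simps)
    finally show "h * (\<Sum>i<n. m i) \<le> integral {p..q} g + \<epsilon>"
      using sums[of n] \<open>c n = q\<close> by simp
  qed
qed

text \<open>A multiple of the heat kernel at time \<open>t + s\<close> times \<open>exp (2 * t)\<close>; the prefactor
  \<open>1 / sqrt (t + s)\<close> is absorbed into the exponent to simplify differentiation.\<close>

definition gauss :: "real \<Rightarrow> real \<Rightarrow> real \<Rightarrow> real" where
  "gauss s t x = exp (2 * t - x\<^sup>2 / (t + s) / 2 - ln (t + s) / 2)"

lemma gauss_dt:
  assumes "t + s > 0"
  shows "((\<lambda>t. gauss s t x) has_real_derivative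
    (2 + x\<^sup>2 / (t + s)\<^sup>2 / 2 - 1 / (t + s) / 2) * gauss s t x) (at t)"
proof -
  have "((\<lambda>t. 2 * t - x\<^sup>2 / (t + s) / 2 - ln (t + s) / 2) has_real_derivative
      2 + x\<^sup>2 / (t + s)\<^sup>2 / 2 - 1 / (t + s) / 2) (at t)"
  proof -
    have a: "((\<lambda>t. x\<^sup>2 / (t + s)) has_real_derivative - (x\<^sup>2 / (t + s)\<^sup>2)) (at t)"
      using assms by (auto intro!: derivative_eq_intros simp: power2_eq_square)
    have b: "((\<lambda>t. ln (t + s)) has_real_derivative 1 / (t + s)) (at t)"
      using assms by (auto intro!: derivative_eq_intros)
    show ?thesis
      using DERIV_diff[OF DERIV_diff[OF DERIV_cmult_Id[of 2] DERIV_cdivide[OF a, of 2]]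
          DERIV_cdivide[OF b, of 2]] by simp
  qed
  from DERIV_fun_exp[OF this] show ?thesis by (simp add: gauss_def mult.commute)
qed

lemma gauss_dx:
  assumes "t + s > 0"
  shows "(gauss s t has_real_derivative (- x / (t + s)) * gauss s t x) (at x)"
proof -
  have "((\<lambda>x. 2 * t - x\<^sup>2 / (t + s) / 2 - ln (t + s) / 2) has_real_derivative - x / (t + s)) (at x)"
    using assms by (auto intro!: derivative_eq_intros simp: divide_simps)
  from DERIV_fun_exp[OF this] show ?thesis by (simp add: gauss_def[abs_def] mult.commute)
qed

lemma gauss_dxx:
  assumes "t + s > 0"
  shows "((\<lambda>x. (- x / (t + s)) * gauss s t x) has_real_derivative
    (x\<^sup>2 / (t + s)\<^sup>2 - 1 / (t + s)) * gauss s t x) (at x)"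
proof -
  have "((\<lambda>x. - x / (t + s)) has_real_derivative - 1 / (t + s)) (at x)"
    using assms by (auto intro!: derivative_eq_intros)
  from DERIV_mult[OF this gauss_dx[OF assms]] show ?thesis
    by (rule back_subst[of "\<lambda>D. (_ has_real_derivative D) (at x)"])
      (simp add: power2_eq_square algebra_simps)
qed

context fbp_solution begin

text \<open>\<open>U\<^sub>0\<close> may jump, so the distance to it is replaced by continuous
  minorants, such as the positive part of \<open>U t x\<close> minus a continuous majorant of
  \<open>U\<^sub>0\<close>. For these the ordinary integral is available.\<close>

lemma initial_L1:
  assumes "\<And>t. t > 0 \<Longrightarrow> continuous_on {p..q} (g t)"
    and nonneg: "\<And>t x. t > 0 \<Longrightarrow> x \<in> {p..q} \<Longrightarrow> 0 \<le> g t x"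
    and le: "\<And>t x. t > 0 \<Longrightarrow> x \<in> {p..q} \<Longrightarrow> g t x \<le> \<bar>U t x - U\<^sub>0 x\<bar>"
  shows "((\<lambda>t. integral {p..q} (g t)) \<longlongrightarrow> 0) (at_right 0)"
proof -
  let ?N = "\<lambda>t. \<integral>\<^sup>+x\<in>{p..q}. ennreal \<bar>U t x - U\<^sub>0 x\<bar> \<partial>lborel"
  have bound: "ennreal (integral {p..q} (g t)) \<le> ?N t" if "t > 0" for t
  proof -
    have "ennreal (integral {p..q} (g t)) = (\<integral>\<^sup>+x\<in>{p..q}. ennreal (g t x) \<partial>lborel)"
      using assms that by (intro ennreal_integral_continuous) auto
    also have "\<dots> \<le> ?N t"
      using le[OF that] by (intro nn_integral_mono) (auto simp: indicator_def intro: ennreal_leI)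
    finally show ?thesis .
  qed
  have pos: "\<forall>\<^sub>F t in at_right 0. (0::real) < t"
    by (rule eventually_at_right_less)
  have "(?N \<longlongrightarrow> 0) (at_right 0)"
    using U_init unfolding tendsto_L1_loc_def by auto
  then have "((\<lambda>t. ennreal (integral {p..q} (g t))) \<longlongrightarrow> 0) (at_right 0)"
    by (rule tendsto_sandwich[OF _ _ tendsto_const, rotated 2])
      (use pos bound in \<open>auto elim!: eventually_mono\<close>)
  then have "((\<lambda>t. ennreal (integral {p..q} (g t))) \<longlongrightarrow> ennreal 0) (at_right 0)" by simp
  then show ?thesis
  proof (rule tendsto_ennrealD)
    show "\<forall>\<^sub>F t in at_right 0. 0 \<le> integral {p..q} (g t)"
      using pos by eventually_elim
        (use assms in \<open>auto intro!: integral_nonneg integrable_continuous_real\<close>)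
  qed simp
qed

section \<open>Exponential supersolutions\<close>

text \<open>The right-hand side solves the linear equation on the whole line exactly and so lacks
  the strictness that \<open>comparison\<close> asks for. The proof adds two positive corrections,
  controlled by \<open>\<eta>\<close> and \<open>\<epsilon>\<^sub>0\<close>, and removes them at the
  end.\<close>

lemma U_le_exponential:
  assumes "r > 0" "B > 0" and U0_le: "\<And>x. U\<^sub>0 x \<le> B * exp (- r * x)" and "t\<^sub>1 > 0"
  shows "U t\<^sub>1 x\<^sub>1 \<le> B * exp ((1 + r\<^sup>2 / 2) * t\<^sub>1 - r * x\<^sub>1)"
proof -
  let ?E = "\<lambda>t x. B * exp ((1 + r\<^sup>2 / 2) * t - r * x)"
  have bound: "U t\<^sub>1 x\<^sub>1 \<le> ?E t\<^sub>1 x\<^sub>1 + \<eta> * exp (x\<^sub>1 + 2 * t\<^sub>1) + \<epsilon>\<^sub>0"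
    if "\<eta> > 0" "\<epsilon>\<^sub>0 > 0" for \<eta> \<epsilon>\<^sub>0
  proof -
    \<comment> \<open>The exponential exceeds 1 far to the left, the added term far to the right.
      The added term has time rate 2 against the required \<open>1/2 + 1\<close>, which leaves a
      surplus of half its value.\<close>
    define P where "P t x = ?E t x + \<eta> * exp (x + 2 * t)" for t x
    define R where "R = max 1 (max (- ln B / r) (- ln \<eta>))"
    have R: "R \<ge> 1" "- ln B / r \<le> R" "- ln \<eta> \<le> R" by (auto simp: R_def)
    have P_lat: "1 < P t x" if "t \<ge> 0" "R < \<bar>x\<bar>" for t x
    proof (cases "x > 0")
      case True
      then have "0 < ln \<eta> + (x + 2 * t)" using R that by auto
      then have "1 < exp (ln \<eta> + (x + 2 * t))" by simp
      also have "\<dots> = \<eta> * exp (x + 2 * t)" using \<open>\<eta> > 0\<close> by (simp add: exp_add)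
      also have "\<dots> < P t x" using \<open>B > 0\<close> by (simp add: P_def)
      finally show ?thesis .
    next
      case False
      have "- ln B \<le> r * R" using R(2) \<open>r > 0\<close> by (simp add: field_simps)
      moreover have "r * R < r * - x" using False that \<open>r > 0\<close> by (intro mult_strict_left_mono) auto
      moreover have "0 \<le> (1 + r\<^sup>2 / 2) * t" using that by simp
      ultimately have "0 < ln B + ((1 + r\<^sup>2 / 2) * t - r * x)" by linarith
      then have "1 < exp (ln B + ((1 + r\<^sup>2 / 2) * t - r * x))" by simp
      also have "\<dots> = ?E t x" using \<open>B > 0\<close> by (simp add: exp_add)
      also have "\<dots> < P t x" using \<open>\<eta> > 0\<close> by (simp add: P_def)
      finally show ?thesis .
    qed
    have P_cont: "continuous_on A (P t)" for A t
      unfolding P_def by (intro continuous_intros)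
    have U0_le_P: "U\<^sub>0 x \<le> P t x" if "t \<ge> 0" for t x
    proof -
      have "U\<^sub>0 x \<le> B * exp (- r * x)" by (rule U0_le)
      also have "\<dots> \<le> ?E t x" using that \<open>B > 0\<close> by (intro mult_left_mono) auto
      also have "\<dots> \<le> P t x" using \<open>\<eta> > 0\<close> by (simp add: P_def)
      finally show ?thesis .
    qed
    define g where "g t x = max 0 (U t x - P t x)" for t x
    have g_nonneg: "0 \<le> g t x" for t x by (simp add: g_def)
    have g_cont: "continuous_on A (g t)" if "t > 0" for A t
      unfolding g_def using that by (intro continuous_intros U_slice_cont P_cont)
    have "((\<lambda>t. integral {-R..R} (g t)) \<longlongrightarrow> 0) (at_right 0)"
    proof (rule initial_L1)
      show "g t x \<le> \<bar>U t x - U\<^sub>0 x\<bar>" if "t > 0" for t x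
        using U0_le_P[of t x] that by (auto simp: g_def)
    qed (use g_cont g_nonneg in auto)
    \<comment> \<open>\<open>M\<close> bounds the value at time \<open>t\<^sub>1\<close> per unit of
      \<open>h * m i\<close>. The second factor bounds every Gaussian whose age
      \<open>t\<^sub>1 - \<tau> + h\<^sup>2\<close> is at least \<open>t\<^sub>1 / 2\<close>; the
      first is the normalisation in \<open>C\<close>.\<close>
    define M where "M = exp (1/2) * exp (2 * t\<^sub>1 - ln (t\<^sub>1 / 2) / 2)"
    define \<epsilon> where "\<epsilon> = \<epsilon>\<^sub>0 / (2 * M)"
    have "M > 0" "\<epsilon> > 0" using \<open>\<epsilon>\<^sub>0 > 0\<close> by (auto simp: M_def \<epsilon>_def)
    have "\<forall>\<^sub>F t in at_right 0. integral {-R..R} (g t) < \<epsilon>"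
      using \<open>((\<lambda>t. integral {-R..R} (g t)) \<longlongrightarrow> 0) (at_right 0)\<close> \<open>\<epsilon> > 0\<close> by (rule order_tendstoD)
    moreover have "\<forall>\<^sub>F t in at_right 0. t \<in> {0<..<t\<^sub>1/2}"
      using \<open>t\<^sub>1 > 0\<close> by (intro eventually_at_right_real) auto
    ultimately have "\<forall>\<^sub>F t in at_right 0. integral {-R..R} (g t) < \<epsilon> \<and> t \<in> {0<..<t\<^sub>1/2}"
      by (rule eventually_conj)
    from eventually_happens'[OF trivial_limit_at_right_real this]
    obtain \<tau> where \<tau>: "0 < \<tau>" "\<tau> < t\<^sub>1 / 2" "integral {-R..R} (g \<tau>) < \<epsilon>"
      by auto
    obtain n h c m where h: "h > 0" and m: "\<And>i. i < (n::nat) \<Longrightarrow> 0 \<le> m i"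
      and cover: "\<And>x. x \<in> {-R..R} \<Longrightarrow> \<exists>i<n. \<bar>x - c i\<bar> \<le> h \<and> g \<tau> x < m i"
      and mass: "h * (\<Sum>i<n. m i) \<le> integral {-R..R} (g \<tau>) + \<epsilon>"
      by (rule finite_bump_cover[of "-R" R "g \<tau>" \<epsilon>])
        (use R \<tau> \<open>\<epsilon> > 0\<close> g_cont[of \<tau>] g_nonneg in auto)
    \<comment> \<open>At time \<tau> the kernel is at least \<open>exp (- 1/2) / h\<close> within
      distance \<open>h\<close> of its centre, so this coefficient lifts it to height
      \<open>m i\<close> there.\<close>
    define C where "C i = m i * h * exp (1/2)" for i
    have C_nonneg: "0 \<le> C i" if "i < n" for i using m[OF that] h by (simp add: C_def)
    \<comment> \<open>The initial data is attained only in \<open>L\<^sup>1\<close>: Gaussian bumps of width \<open>h\<close> dominate the excess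
      \<open>g \<tau>\<close>, whose integral is small, and have spread out by time \<open>t\<^sub>1\<close>.\<close>
    define Z where "Z t x = (\<Sum>i<n. C i * gauss (h\<^sup>2) (t - \<tau>) (x - c i))" for t x
    have Z_nonneg: "0 \<le> Z t x" for t x
      using C_nonneg by (auto simp: Z_def gauss_def intro!: sum_nonneg)
    have pos: "t - \<tau> + h\<^sup>2 > 0" if "\<tau> \<le> t" for t using that h by (simp add: add_nonneg_pos)
    define Pt where "Pt t x = (1 + r\<^sup>2 / 2) * ?E t x + 2 * (\<eta> * exp (x + 2 * t))" for t x
    define Px where "Px t x = - r * ?E t x + \<eta> * exp (x + 2 * t)" for t x
    define Pxx where "Pxx t x = r\<^sup>2 * ?E t x + \<eta> * exp (x + 2 * t)" for t x
    let ?d = "\<lambda>t. t - \<tau> + h\<^sup>2"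
    define Zt where "Zt t x = (\<Sum>i<n. C i * ((2 + (x - c i)\<^sup>2 / (?d t)\<^sup>2 / 2 - 1 / ?d t / 2) *
        gauss (h\<^sup>2) (t - \<tau>) (x - c i)))" for t x
    define Zx where "Zx t x = (\<Sum>i<n. C i * ((- (x - c i) / ?d t) *
        gauss (h\<^sup>2) (t - \<tau>) (x - c i)))" for t x
    define Zxx where "Zxx t x = (\<Sum>i<n. C i * (((x - c i)\<^sup>2 / (?d t)\<^sup>2 - 1 / ?d t) *
        gauss (h\<^sup>2) (t - \<tau>) (x - c i)))" for t x
    have Z_pde: "Zt t x = 1/2 * Zxx t x + 2 * Z t x" for t x
      unfolding Zt_def Zxx_def Z_def sum_distrib_left sum.distrib[symmetric]
      by (intro sum.cong) (auto simp: algebra_simps)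
    \<comment> \<open>\<open>Z\<close> satisfies its equation with \<open>2 * Z\<close> in place of
      \<open>Z\<close>, so it only helps. The chosen \<kappa> is a lower bound for the surplus of
      the \<open>\<eta>\<close> term where \<open>\<bar>x\<bar> \<le> R + 1\<close>.\<close>
    have "U t\<^sub>1 x\<^sub>1 < P t\<^sub>1 x\<^sub>1 + Z t\<^sub>1 x\<^sub>1"
    proof (rule comparison[where \<tau> = \<tau> and T = t\<^sub>1 and R = R
          and \<kappa> = "\<eta> * exp (- (R + 1)) / 2"
          and S = "\<lambda>t x. P t x + Z t x" and St = "\<lambda>t x. Pt t x + Zt t x"
          and Sx = "\<lambda>t x. Px t x + Zx t x" and Sxx = "\<lambda>t x. Pxx t x + Zxx t x"])
      fix t x assume t: "\<tau> \<le> t" "t \<le> t\<^sub>1"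
      have shift: "((\<lambda>y. y - a) has_real_derivative 1) (at z)" for a z :: real
        by (auto intro!: derivative_eq_intros)
      have g_dt: "((\<lambda>t. gauss (h\<^sup>2) (t - \<tau>) y) has_real_derivative
          (2 + y\<^sup>2 / (?d t)\<^sup>2 / 2 - 1 / ?d t / 2) * gauss (h\<^sup>2) (t - \<tau>) y) (at t)" for y
        using DERIV_chain2[OF gauss_dt[OF pos[OF t(1)], of y] shift[of \<tau> t]] by simp
      show "((\<lambda>s. P s x + Z s x) has_real_derivative Pt t x + Zt t x) (at t)"
      proof (rule DERIV_add)
        show "((\<lambda>s. P s x) has_real_derivative Pt t x) (at t)"
          unfolding P_def Pt_def by (auto intro!: derivative_eq_intros)
        show "((\<lambda>s. Z s x) has_real_derivative Zt t x) (at t)"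
          unfolding Z_def Zt_def by (intro DERIV_sum DERIV_cmult g_dt)
      qed
      have g_dx: "((\<lambda>x. gauss (h\<^sup>2) (t - \<tau>) (x - a)) has_real_derivative
          (- (x - a) / ?d t) * gauss (h\<^sup>2) (t - \<tau>) (x - a)) (at x)" for a
        using DERIV_chain2[OF gauss_dx[OF pos[OF t(1)], of "x - a"] shift[of a x]] by simp
      show "((\<lambda>y. P t y + Z t y) has_real_derivative Px t x + Zx t x) (at x)"
      proof (rule DERIV_add)
        show "(P t has_real_derivative Px t x) (at x)"
          unfolding P_def Px_def by (auto intro!: derivative_eq_intros)
        show "(Z t has_real_derivative Zx t x) (at x)"
          unfolding Z_def Zx_def by (intro DERIV_sum DERIV_cmult g_dx)
      qed
      have g_dxx: "((\<lambda>x. (- (x - a) / ?d t) * gauss (h\<^sup>2) (t - \<tau>) (x - a)) has_real_derivative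
          ((x - a)\<^sup>2 / (?d t)\<^sup>2 - 1 / ?d t) * gauss (h\<^sup>2) (t - \<tau>) (x - a)) (at x)" for a
        using DERIV_chain2[OF gauss_dxx[OF pos[OF t(1)], of "x - a"] shift[of a x]] by simp
      show "((\<lambda>y. Px t y + Zx t y) has_real_derivative Pxx t x + Zxx t x) (at x)"
      proof (rule DERIV_add)
        show "(Px t has_real_derivative Pxx t x) (at x)"
          unfolding Px_def Pxx_def by (auto intro!: derivative_eq_intros simp: power2_eq_square)
        show "(Zx t has_real_derivative Zxx t x) (at x)"
          unfolding Zx_def Zxx_def by (intro DERIV_sum DERIV_cmult g_dxx)
      qed
      show "1/2 * (Pxx t x + Zxx t x) + (P t x + Z t x) + \<eta> * exp (- (R + 1)) / 2 \<le> Pt t x + Zt t x"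
        if "\<bar>x\<bar> \<le> R + 1"
      proof -
        have "\<eta> * exp (- (R + 1)) \<le> \<eta> * exp (x + 2 * t)"
          using that t \<tau> \<open>\<eta> > 0\<close> by (intro mult_left_mono) auto
        moreover have "Pt t x = 1/2 * Pxx t x + P t x + \<eta> * exp (x + 2 * t) / 2"
          by (simp add: Pt_def Pxx_def P_def algebra_simps)
        moreover have "1/2 * (q + q') + (p + z) + e / 2 \<le> p' + z'"
          if "e \<le> e'" "p' = 1/2 * q + p + e' / 2" "z' = 1/2 * q' + 2 * z" "0 \<le> z"
          for e e' p p' q q' z z' :: real
          using that by (simp add: add_divide_distrib)
        ultimately show ?thesis using Z_pde Z_nonneg by blast
      qed
      show "1 < P t x + Z t x" if "R < \<bar>x\<bar>"
        using P_lat[of t x] Z_nonneg[of t x] that t \<tau> by auto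
    next
      show "continuous_on ({\<tau>..t\<^sub>1} \<times> UNIV) (\<lambda>(t, x). P t x + Z t x)"
        unfolding P_def Z_def gauss_def case_prod_unfold
        by (intro continuous_intros) (auto dest!: pos)
    next
      fix x
      show "U \<tau> x < P \<tau> x + Z \<tau> x"
      proof (cases "R < \<bar>x\<bar>")
        case True
        then show ?thesis using P_lat[of \<tau> x] Z_nonneg[of \<tau> x] U_range(2)[of \<tau> x] \<tau> by auto
      next
        case False
        then have "x \<in> {-R..R}" by auto
        from cover[OF this] obtain i where i: "i < n" "\<bar>x - c i\<bar> \<le> h" "g \<tau> x < m i" by auto
        have "(x - c i)\<^sup>2 \<le> h\<^sup>2" using i(2) h by (simp add: abs_le_square_iff[symmetric])
        then have "- (1/2) \<le> - ((x - c i)\<^sup>2 / h\<^sup>2 / 2)" using h by (simp add: field_simps)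
        then have "exp (- (1/2) - ln h) \<le> gauss (h\<^sup>2) 0 (x - c i)"
          using h by (simp add: gauss_def ln_realpow)
        then have "C i * exp (- (1/2) - ln h) \<le> C i * gauss (h\<^sup>2) 0 (x - c i)"
          using C_nonneg[OF i(1)] by (intro mult_left_mono) auto
        also have "C i * exp (- (1/2) - ln h) = m i"
          using h by (simp add: C_def exp_diff exp_minus)
        also have "C i * gauss (h\<^sup>2) 0 (x - c i) \<le> Z \<tau> x"
          unfolding Z_def using i(1) C_nonneg
          by (intro member_le_sum[of i "{..<n}" "\<lambda>i. C i * gauss (h\<^sup>2) 0 (x - c i)", THEN order_trans])
            (auto simp: gauss_def)
        finally show ?thesis using i(3) by (simp add: g_def)
      qed
    qed (use \<tau> \<open>\<eta> > 0\<close> in auto)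
    also have "Z t\<^sub>1 x\<^sub>1 \<le> \<epsilon>\<^sub>0"
    proof -
      have "gauss (h\<^sup>2) (t\<^sub>1 - \<tau>) y \<le> exp (2 * t\<^sub>1 - ln (t\<^sub>1 / 2) / 2)" for y
      proof -
        define l where "l = ln (t\<^sub>1 - \<tau> + h\<^sup>2)"
        define q where "q = y\<^sup>2 / (t\<^sub>1 - \<tau> + h\<^sup>2) / 2"
        have "ln (t\<^sub>1 / 2) \<le> l" "0 \<le> q"
          using \<tau> pos[of t\<^sub>1] by (auto simp: l_def q_def add_increasing2 intro!: ln_mono)
        then have "2 * (t\<^sub>1 - \<tau>) - q - l / 2 \<le> 2 * t\<^sub>1 - ln (t\<^sub>1 / 2) / 2" using \<tau> by simp
        then show ?thesis unfolding gauss_def l_def q_def by simp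
      qed
      then have "Z t\<^sub>1 x\<^sub>1 \<le> (\<Sum>i<n. C i * exp (2 * t\<^sub>1 - ln (t\<^sub>1 / 2) / 2))"
        unfolding Z_def using C_nonneg by (intro sum_mono mult_left_mono) auto
      also have "\<dots> = M * (h * (\<Sum>i<n. m i))"
        by (simp add: C_def M_def sum_distrib_left sum_distrib_right mult_ac)
      also have "\<dots> \<le> M * (2 * \<epsilon>)" using mass \<tau>(3) \<open>M > 0\<close> by (intro mult_left_mono) auto
      also have "\<dots> = \<epsilon>\<^sub>0" using \<open>M > 0\<close> by (simp add: \<epsilon>_def)
      finally show ?thesis .
    qed
    finally show ?thesis by (simp add: P_def)
  qed
  show ?thesis
  proof (rule field_le_epsilon)
    fix e :: real assume "e > 0"
    show "U t\<^sub>1 x\<^sub>1 \<le> ?E t\<^sub>1 x\<^sub>1 + e"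
      using bound[of "e / 2 / exp (x\<^sub>1 + 2 * t\<^sub>1)" "e / 2"] \<open>e > 0\<close> by simp
  qed
qed

text \<open>\<open>U\<close> equals 1 at \<open>L t\<close>, so the exponential bound is at least 1
  there; its logarithm gives the line.\<close>

lemma L_le_linear:
  assumes "r > 0" and "\<And>x. U\<^sub>0 x \<le> B * exp (- r * x)" and "B > 0" "t > 0"
  shows "L t \<le> (1 / r + r / 2) * t + ln B / r"
proof -
  have "1 \<le> B * exp ((1 + r\<^sup>2 / 2) * t - r * L t)"
    using U_le_exponential[of r B t "L t"] U_left[of t "L t"] assms by auto
  then have "ln 1 \<le> ln (B * exp ((1 + r\<^sup>2 / 2) * t - r * L t))" by (subst ln_le_cancel_iff) auto
  then have "r * L t \<le> ln B + (1 + r\<^sup>2 / 2) * t" using \<open>B > 0\<close> by (simp add: ln_mult)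
  then show ?thesis using \<open>r > 0\<close> by (simp add: field_simps power2_eq_square)
qed

end

section \<open>Moving eigenfunctions\<close>

definition bump :: "real \<Rightarrow> real \<Rightarrow> real \<Rightarrow> real" where
  "bump v w y = exp (v * y) * sin (pi / w * y)"

definition bump' :: "real \<Rightarrow> real \<Rightarrow> real \<Rightarrow> real" where
  "bump' v w y = exp (v * y) * (v * sin (pi / w * y) + pi / w * cos (pi / w * y))"

lemma bump_deriv: "(bump v w has_real_derivative bump' v w y) (at y)"
proof -
  define k where "k = pi / w"
  show ?thesis
    unfolding bump_def[abs_def] bump'_def k_def[symmetric]
    by (auto intro!: derivative_eq_intros simp: algebra_simps)
qed

text \<open>In this form \<open>1/2 * f'' - v * f' + f\<close>, for \<open>f = bump v w\<close>,
  collapses to a multiple of \<open>f\<close>: the first-order terms cancel.\<close>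

lemma bump'_deriv:
  "(bump' v w has_real_derivative 2 * v * bump' v w y - (v\<^sup>2 + (pi / w)\<^sup>2) * bump v w y) (at y)"
proof -
  define k where "k = pi / w"
  show ?thesis
    unfolding bump_def bump'_def[abs_def] k_def[symmetric]
    by (auto intro!: derivative_eq_intros simp: algebra_simps power2_eq_square)
qed

lemma bump_cont: "continuous_on A (bump v w)"
  unfolding bump_def[abs_def] by (intro continuous_intros)

lemma bump_pos:
  assumes "0 < y" "y < w" shows "0 < bump v w y"
proof -
  have "pi / w * y < pi" using assms by (simp add: field_simps)
  then have "0 < sin (pi / w * y)" using assms by (intro sin_gt_zero) auto
  then show ?thesis unfolding bump_def by (intro mult_pos_pos) auto
qed

lemma bump_nonneg: "0 \<le> y \<Longrightarrow> y \<le> w \<Longrightarrow> 0 \<le> bump v w y"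
  using bump_pos[of y w v] by (cases "y = 0 \<or> y = w") (auto simp: bump_def)

lemma bump_integral_pos:
  assumes "w > 0" shows "0 < integral {0..w} (bump v w)"
proof -
  have "integral {0..w} (bump v w) \<noteq> 0"
    using integral_eq_0_iff[of 0 w "bump v w"] bump_cont bump_nonneg bump_pos[of "w/2" w v] assms
    by force
  moreover have "0 \<le> integral {0..w} (bump v w)"
    by (intro integral_nonneg integrable_continuous_real bump_cont bump_nonneg) auto
  ultimately show ?thesis by simp
qed

context fbp_solution begin

text \<open>\<open>C12_on\<close> provides partial derivatives, while differentiating along a moving
  line needs the joint one. Continuity of \<open>dx U\<close> on a rectangle ahead of the boundary
  supplies it; the midpoint \<open>m\<close> leaves room for the boundary to move.\<close>

lemma U_has_derivative:
  assumes "t > 0" "L t < x"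
  shows "((\<lambda>(t, x). U t x) has_derivative (\<lambda>(h, k). dt U t x * h + dx U t x * k)) (at (t, x))"
proof -
  define m where "m = (L t + x) / 2"
  have m: "L t < m" "m < x" using assms by (auto simp: m_def)
  obtain d where d: "d > 0" "d < t" and L: "\<And>s. \<bar>s - t\<bar> < d \<Longrightarrow> L s < m"
    using L_eventually_less[OF \<open>t > 0\<close> m(1)] by auto
  define X where "X = {t - d<..<t + d}"
  define Y where "Y = {m<..}"
  have pos: "s > 0" "L s < y" if "s \<in> X" "y \<in> Y" for s y
    using that L[of s] d by (auto simp: X_def Y_def abs_less_iff)
  have tx: "t \<in> X" "x \<in> Y" using d m by (auto simp: X_def Y_def)
  have "open (X \<times> Y)" by (auto simp: X_def Y_def open_Times)
  have "((\<lambda>(t, x). U t x) has_derivative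
      (\<lambda>(h, k). dt U t x * h + blinfun_mult_right (dx U t x) k)) (at (t, x) within X \<times> Y)"
  proof (rule has_derivative_partialsI)
    show "((\<lambda>s. U s x) has_derivative (*) (dt U t x)) (at t within X)"
      using U_dt[OF assms] unfolding has_field_derivative_def by (rule has_derivative_at_withinI)
    show "((\<lambda>y. U s y) has_derivative blinfun_apply (blinfun_mult_right (dx U s y))) (at y within Y)"
      if "s \<in> X" "y \<in> Y" for s y
      using U_dx[OF pos[OF that]] unfolding has_field_derivative_def
      by (auto intro: has_derivative_at_withinI)
    have "continuous_on (X \<times> Y) (\<lambda>(s, y). dx U s y)"
      using U_C12 pos unfolding C12_on_def by (auto elim!: continuous_on_subset)
    then have "continuous_on (X \<times> Y) (\<lambda>(s, y). blinfun_mult_right (dx U s y))"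
      unfolding case_prod_unfold
      by (rule bounded_linear.continuous_on[OF bounded_linear_blinfun_mult_right])
    then show "continuous (at (t, x) within X \<times> Y) (\<lambda>(s, y). blinfun_mult_right (dx U s y))"
      using tx by (auto simp: continuous_on_eq_continuous_within)
    show "convex Y" by (simp add: Y_def)
  qed (use tx in auto)
  then show ?thesis
    using at_within_open[OF _ \<open>open (X \<times> Y)\<close>, of "(t, x)"] tx by simp
qed

lemma U_moving_deriv:
  assumes "t > 0" "L t < b + v * t"
  shows "((\<lambda>s. U s (b + v * s)) has_real_derivative
    dt U t (b + v * t) + v * dx U t (b + v * t)) (at t)"
proof -
  have "((\<lambda>s. (s, b + v * s)) has_derivative (\<lambda>h. (h, v * h))) (at t)"
    by (auto intro!: derivative_eq_intros)
  from has_derivative_compose[OF this U_has_derivative[OF assms]]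
  have "((\<lambda>s. U s (b + v * s)) has_derivative
      (\<lambda>h. dt U t (b + v * t) * h + dx U t (b + v * t) * (v * h))) (at t)" by simp
  moreover have "(\<lambda>h. dt U t (b + v * t) * h + dx U t (b + v * t) * (v * h)) =
      (*) (dt U t (b + v * t) + v * dx U t (b + v * t))"
    by (auto simp: fun_eq_iff algebra_simps)
  ultimately show ?thesis unfolding has_field_derivative_def by simp
qed

text \<open>Kaplan's functional. The parameter \<open>a\<close> is the left end of the window traced
  back to time 0.\<close>

definition bump_mass :: "real \<Rightarrow> real \<Rightarrow> real \<Rightarrow> real \<Rightarrow> real" where
  "bump_mass a v w t = integral {0..w} (\<lambda>y. U t (a + v * t + y) * bump v w y)"

lemma U_shift_cont: "t > 0 \<Longrightarrow> continuous_on A (\<lambda>y. U t (b + y))"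
  by (rule continuous_on_compose2[OF U_slice_cont[of t UNIV]]) (auto intro: continuous_intros)

lemma bump_mass_le:
  assumes "t > 0" shows "bump_mass a v w t \<le> integral {0..w} (bump v w)"
  unfolding bump_mass_def
proof (rule integral_le)
  show "U t (a + v * t + y) * bump v w y \<le> bump v w y" if "y \<in> {0..w}" for y
    using that U_range[OF assms] bump_nonneg[of y w v] by (auto intro: mult_left_le_one_le)
qed (use assms in \<open>auto intro!: integrable_continuous_real continuous_intros U_shift_cont bump_cont\<close>)

text \<open>\<open>bump v w\<close> is a Dirichlet eigenfunction, with eigenvalue \<open>\<mu>\<close>, of the adjoint of
  \<open>u \<mapsto> u''/2 + v u' + u\<close>, the generator in the frame moving at speed \<open>v\<close>. The boundary terms of the
  integration by parts have a sign because \<open>U \<ge> 0\<close>.\<close>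

lemma bump_mass_growth:
  assumes "w > 0" "0 < \<tau>" "\<tau> \<le> T" and ahead: "\<And>t. \<tau> \<le> t \<Longrightarrow> t \<le> T \<Longrightarrow> L t < a + v * t"
  defines "\<mu> \<equiv> 1 - v\<^sup>2 / 2 - (pi / w)\<^sup>2 / 2"
  shows "exp (\<mu> * (T - \<tau>)) * bump_mass a v w \<tau> \<le> bump_mass a v w T"
proof -
  define \<phi> where "\<phi> = bump v w"
  define \<phi>' where "\<phi>' = bump' v w"
  define ut where "ut t y = dt U t (a + v * t + y) + v * dx U t (a + v * t + y)" for t y
  have pos: "t > 0" "L t < a + v * t + y" if "\<tau> \<le> t" "t \<le> T" "0 \<le> y" for t y
    using ahead[OF that(1,2)] that \<open>0 < \<tau>\<close> by auto
  have move: "continuous_on ({\<tau>..T} \<times> {0..w}) (\<lambda>z. (fst z, a + v * fst z + snd z))"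
    by (intro continuous_intros)
  have image: "(\<lambda>z. (fst z, a + v * fst z + snd z)) ` ({\<tau>..T} \<times> {0..w}) \<subseteq> {(t, x). t > 0 \<and> x > L t}"
    using pos by auto
  have dtc: "continuous_on ({\<tau>..T} \<times> {0..w}) (\<lambda>z. dt U (fst z) (a + v * fst z + snd z))"
    and dxc: "continuous_on ({\<tau>..T} \<times> {0..w}) (\<lambda>z. dx U (fst z) (a + v * fst z + snd z))"
    using U_C12 continuous_on_compose2[OF _ move image, of "\<lambda>(t, x). dt U t x"]
      continuous_on_compose2[OF _ move image, of "\<lambda>(t, x). dx U t x"]
    unfolding C12_on_def by simp_all
  have \<phi>c: "continuous_on ({\<tau>..T} \<times> {0..w}) (\<lambda>z. \<phi> (snd z))"
    unfolding \<phi>_def by (rule continuous_on_compose2[OF bump_cont[of UNIV]]) (auto intro: continuous_intros)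
  have K_deriv: "(bump_mass a v w has_real_derivative integral {0..w} (\<lambda>y. ut t y * \<phi> y))
      (at t within {\<tau>..T})" if t: "\<tau> \<le> t" "t \<le> T" for t
  proof -
    have "((\<lambda>t. integral (cbox 0 w) (\<lambda>y. U t (a + v * t + y) * \<phi> y)) has_real_derivative
        integral (cbox 0 w) (\<lambda>y. ut t y * \<phi> y)) (at t within {\<tau>..T})"
    proof (rule leibniz_rule_field_derivative)
      show "((\<lambda>t. U t (a + v * t + y) * \<phi> y) has_real_derivative ut t y * \<phi> y) (at t within {\<tau>..T})"
        if "t \<in> {\<tau>..T}" "y \<in> cbox 0 w" for t y
      proof -
        have "t > 0" "L t < a + y + v * t" using pos[of t y] that by auto
        from U_moving_deriv[OF this] show ?thesis
          by (intro DERIV_cmult_right) (auto simp: ut_def algebra_simps intro: DERIV_subset)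
      qed
      show "(\<lambda>y. U t (a + v * t + y) * \<phi> y) integrable_on cbox 0 w" if "t \<in> {\<tau>..T}" for t
        using that \<open>0 < \<tau>\<close> unfolding \<phi>_def
        by (intro integrable_continuous continuous_on_mult U_shift_cont bump_cont) auto
      show "continuous_on ({\<tau>..T} \<times> cbox 0 w) (\<lambda>(t, y). ut t y * \<phi> y)"
        unfolding ut_def case_prod_unfold using dtc dxc \<phi>c by (auto intro!: continuous_intros)
    qed (use t in auto)
    then show ?thesis by (simp add: bump_mass_def[abs_def] \<phi>_def)
  qed
  have K_growth: "\<mu> * bump_mass a v w t \<le> integral {0..w} (\<lambda>y. ut t y * \<phi> y)"
    if t: "\<tau> \<le> t" "t \<le> T" for t
  proof -
    let ?u = "\<lambda>y. U t (a + v * t + y)"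
    let ?ux = "\<lambda>y. dx U t (a + v * t + y)"
    let ?uxx = "\<lambda>y. dxx U t (a + v * t + y)"
    \<comment> \<open>The antiderivative produced by integrating by parts. At both ends
      \<open>\<phi>\<close> vanishes and only \<open>- ?u y * \<phi>' y / 2\<close> survives;
      \<open>\<phi>'\<close> is positive at 0 and negative at \<open>w\<close>.\<close>
    define G where "G y = ?ux y * \<phi> y / 2 - ?u y * \<phi>' y / 2 + v * ?u y * \<phi> y" for y
    have G_deriv: "(G has_real_derivative ut t y * \<phi> y - \<mu> * (?u y * \<phi> y)) (at y)"
      if y: "0 \<le> y" for y
    proof -
      have p: "t > 0" "L t < a + v * t + y" using pos[OF t y] by auto
      have u: "(?u has_real_derivative ?ux y) (at y)"
        using DERIV_shift[of "U t" "?ux y" y "a + v * t"] U_dx[OF p] by (simp add: add.commute)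
      have ux: "(?ux has_real_derivative ?uxx y) (at y)"
        using DERIV_shift[of "dx U t" "?uxx y" y "a + v * t"] U_dxx[OF p] by (simp add: add.commute)
      note \<phi> = bump_deriv[of v w y, folded \<phi>_def \<phi>'_def] bump'_deriv[of v w y, folded \<phi>_def \<phi>'_def]
      define k2 where "k2 = (pi / w)\<^sup>2"
      show ?thesis unfolding G_def[abs_def]
        using DERIV_add[OF DERIV_diff[OF DERIV_cdivide[OF DERIV_mult[OF ux \<phi>(1)], of 2]
              DERIV_cdivide[OF DERIV_mult[OF u \<phi>(2)], of 2]] DERIV_mult[OF DERIV_cmult[OF u, of v] \<phi>(1)]]
        by (rule back_subst[of "\<lambda>D. (_ has_real_derivative D) (at y)"])
          (simp only: ut_def \<mu>_def U_pde[OF p] k2_def[symmetric], simp add: field_simps power2_eq_square)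
    qed
    have "((\<lambda>y. ut t y * \<phi> y - \<mu> * (?u y * \<phi> y)) has_integral G w - G 0) {0..w}"
      using \<open>w > 0\<close> G_deriv
      by (intro fundamental_theorem_of_calculus)
        (auto simp: has_real_derivative_iff_has_vector_derivative[symmetric] intro: DERIV_subset)
    note i1 = this
    have i2: "((\<lambda>y. \<mu> * (?u y * \<phi> y)) has_integral \<mu> * bump_mass a v w t) {0..w}"
      unfolding bump_mass_def \<phi>_def
      by (intro has_integral_mult_right integrable_integral integrable_continuous_real
          continuous_on_mult U_shift_cont bump_cont) (use pos[OF t, of 0] in auto)
    have "((\<lambda>y. ut t y * \<phi> y) has_integral G w - G 0 + \<mu> * bump_mass a v w t) {0..w}"
      using has_integral_add[OF i1 i2] by simp
    moreover have "0 \<le> G w - G 0"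
      using \<open>w > 0\<close> U_range(1)[OF pos(1)[OF t, of 0]]
      by (simp add: G_def \<phi>_def \<phi>'_def bump_def bump'_def)
    ultimately show ?thesis by (simp add: integral_unique)
  qed
  define F where "F t = exp (- \<mu> * t) * bump_mass a v w t" for t
  have F_deriv: "(F has_real_derivative
      exp (- \<mu> * t) * (integral {0..w} (\<lambda>y. ut t y * \<phi> y) - \<mu> * bump_mass a v w t))
      (at t within {\<tau>..T})" if t: "\<tau> \<le> t" "t \<le> T" for t
    unfolding F_def[abs_def]
    by (auto intro!: derivative_eq_intros K_deriv t simp: algebra_simps)
  have "F \<tau> \<le> F T"
  proof (rule DERIV_nonneg_imp_increasing_open[OF \<open>\<tau> \<le> T\<close>])
    show "\<exists>y. (F has_real_derivative y) (at t) \<and> 0 \<le> y" if "\<tau> < t" "t < T" for t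
      using F_deriv[of t] K_growth[of t] that by (fastforce simp: at_within_Icc_at)
    show "continuous_on {\<tau>..T} F"
      using F_deriv by (intro DERIV_continuous_on) auto
  qed
  then have "exp (\<mu> * T) * F \<tau> \<le> exp (\<mu> * T) * F T" by simp
  then show ?thesis by (simp add: F_def flip: mult.assoc exp_add) (simp add: algebra_simps)
qed

end

section \<open>Exponential moments and pointwise decay\<close>

lemma admissible_facts:
  assumes "admissible U\<^sub>0"
  shows "0 \<le> U\<^sub>0 x" "U\<^sub>0 x \<le> 1" "x \<le> y \<Longrightarrow> U\<^sub>0 y \<le> U\<^sub>0 x" "(U\<^sub>0 \<longlongrightarrow> 0) at_top"
  using assms unfolding admissible_def antimono_def by (auto simp: image_subset_iff)

text \<open>On \<open>{x - 1..x}\<close> monotonicity bounds the integrand below by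
  \<open>exp (r * (x - 1)) * U\<^sub>0 x\<close>, and the interval has length 1.\<close>

lemma exp_moment_imp_decay:
  assumes "admissible U\<^sub>0" "r > 0"
    and fin: "(\<integral>\<^sup>+x\<in>{0..}. ennreal (exp (r * x) * U\<^sub>0 x) \<partial>lborel) < \<infinity>"
  obtains B where "B > 0" "\<And>x. U\<^sub>0 x \<le> B * exp (- r * x)"
proof -
  note U0 = admissible_facts[OF assms(1)]
  define I where "I = enn2real (\<integral>\<^sup>+x\<in>{0..}. ennreal (exp (r * x) * U\<^sub>0 x) \<partial>lborel)"
  have I: "(\<integral>\<^sup>+x\<in>{0..}. ennreal (exp (r * x) * U\<^sub>0 x) \<partial>lborel) = ennreal I" "0 \<le> I"
    using fin by (auto simp: I_def)
  \<comment> \<open>\<open>I + 1\<close> in place of \<open>I\<close> makes the constant positive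
    and lets \<open>U\<^sub>0 x \<le> 1\<close> settle the case \<open>x \<le> 1\<close>.\<close>
  have "U\<^sub>0 x \<le> (I + 1) * exp r * exp (- r * x)" for x
  proof (cases "x \<le> 1")
    case True
    then have "1 \<le> exp r * exp (- r * x)" using \<open>r > 0\<close> by (simp flip: exp_add)
    also have "\<dots> \<le> (I + 1) * (exp r * exp (- r * x))" using I(2) by simp
    finally show ?thesis using U0(2)[of x] by simp
  next
    case False
    let ?k = "exp (r * (x - 1)) * U\<^sub>0 x"
    have "ennreal ?k = (\<integral>\<^sup>+y\<in>{x - 1..x}. ennreal ?k \<partial>lborel)"
      by (simp add: nn_integral_cmult_indicator)
    also have "\<dots> \<le> (\<integral>\<^sup>+y\<in>{0..}. ennreal (exp (r * y) * U\<^sub>0 y) \<partial>lborel)"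
    proof (intro nn_integral_mono)
      fix y
      show "ennreal ?k * indicator {x - 1..x} y \<le> ennreal (exp (r * y) * U\<^sub>0 y) * indicator {0..} y"
        using False \<open>r > 0\<close> U0
        by (auto simp: indicator_def intro!: ennreal_leI mult_mono)
    qed
    finally have "?k \<le> I" using I by simp
    also have "I \<le> I + 1" by simp
    finally have "exp (r * (1 - x)) * ?k \<le> exp (r * (1 - x)) * (I + 1)" by simp
    moreover have "exp (r * (1 - x)) * ?k = U\<^sub>0 x"
    proof -
      have "exp (r * (1 - x)) * exp (r * (x - 1)) = 1" by (simp flip: exp_add add: algebra_simps)
      then show ?thesis by (simp flip: mult.assoc)
    qed
    moreover have "exp (r * (1 - x)) = exp r * exp (- r * x)"
      by (simp flip: exp_add add: algebra_simps)
    ultimately have "U\<^sub>0 x \<le> exp r * exp (- r * x) * (I + 1)" by (simp only:)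
    then show ?thesis by (simp only: mult_ac)
  qed
  moreover have "(I + 1) * exp r > 0" using I(2) by (simp add: add_nonneg_pos)
  ultimately show ?thesis using that by blast
qed

text \<open>The converse, at the price of a strictly smaller exponent, whose gap makes the integral
  converge.\<close>

lemma decay_imp_exp_moment:
  fixes r :: real
  assumes "admissible U\<^sub>0" "r < r'" "B > 0" and le: "\<And>x. U\<^sub>0 x \<le> B * exp (- r' * x)"
  shows "(\<integral>\<^sup>+x\<in>{0..}. ennreal (exp (r * x) * U\<^sub>0 x) \<partial>lborel) < \<infinity>"
proof -
  define d where "d = r' - r"
  have "d > 0" using assms by (simp add: d_def)
  have "(\<integral>\<^sup>+x\<in>{0..}. ennreal (exp (r * x) * U\<^sub>0 x) \<partial>lborel)
      \<le> (\<integral>\<^sup>+x\<in>{0..}. ennreal (B * exp (- d * x)) \<partial>lborel)"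
  proof (intro nn_integral_mono mult_right_mono ennreal_leI)
    fix x
    have "exp (r * x) * U\<^sub>0 x \<le> exp (r * x) * (B * exp (- r' * x))"
      using le by (intro mult_left_mono) auto
    also have "\<dots> = B * exp (- d * x)"
      by (simp flip: exp_add add: d_def algebra_simps)
    finally show "exp (r * x) * U\<^sub>0 x \<le> B * exp (- d * x)" .
  qed auto
  also have "\<dots> = ennreal (0 - (- (B / d) * exp (- d * 0)))"
  proof (rule nn_integral_FTC_atLeast)
    show "((\<lambda>x. - (B / d) * exp (- d * x)) has_real_derivative B * exp (- d * x)) (at x)" for x
      using \<open>d > 0\<close> by (auto intro!: derivative_eq_intros)
    have "filterlim (\<lambda>x. - d * x) at_bot at_top"
      using \<open>d > 0\<close> filterlim_tendsto_neg_mult_at_bot[OF tendsto_const[of "- d"] _ filterlim_ident] by auto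
    then have "((\<lambda>x. exp (- d * x)) \<longlongrightarrow> 0) at_top"
      by (rule filterlim_compose[OF exp_at_bot])
    then show "((\<lambda>x. - (B / d) * exp (- d * x)) \<longlongrightarrow> 0) at_top"
      by (rule tendsto_mult_right_zero)
  qed (use \<open>B > 0\<close> in auto)
  also have "\<dots> < \<infinity>" by simp
  finally show ?thesis .
qed

section \<open>Consequences of linear bounds on the boundary\<close>

context fbp_solution begin

text \<open>Continuity on \<open>{0<..}\<close> says nothing near 0. But a boundary beyond
  \<open>p + 1\<close> forces \<open>U = 1\<close> on a unit interval where
  \<open>U\<^sub>0 < 1/2\<close>, against the L1 convergence.\<close>

lemma L_bounded_near_0:
  assumes "admissible U\<^sub>0"
  obtains x\<^sub>0 d where "d > 0" "\<And>t. 0 < t \<Longrightarrow> t < d \<Longrightarrow> L t < x\<^sub>0"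
proof -
  note U0 = admissible_facts[OF assms]
  have "\<forall>\<^sub>F x in at_top. U\<^sub>0 x < 1/2" using U0(4) by (rule order_tendstoD) simp
  then obtain p where p: "\<And>x. x \<ge> p \<Longrightarrow> U\<^sub>0 x < 1/2"
    by (auto simp: eventually_at_top_linorder)
  have "((\<lambda>t. integral {p..p+1} (\<lambda>x. max 0 (U t x - 1/2))) \<longlongrightarrow> 0) (at_right 0)"
  proof (rule initial_L1)
    show "continuous_on {p..p+1} (\<lambda>x. max 0 (U t x - 1/2))" if "t > 0" for t
      using that by (intro continuous_intros U_slice_cont)
    show "max 0 (U t x - 1/2) \<le> \<bar>U t x - U\<^sub>0 x\<bar>" if "x \<in> {p..p+1}" for t x
      using p[of x] that by auto
  qed auto
  then have "\<forall>\<^sub>F t in at_right 0. integral {p..p+1} (\<lambda>x. max 0 (U t x - 1/2)) < 1/2"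
    by (rule order_tendstoD) simp
  then obtain d where d: "d > 0"
    "\<And>t. 0 < t \<Longrightarrow> t < d \<Longrightarrow> integral {p..p+1} (\<lambda>x. max 0 (U t x - 1/2)) < 1/2"
    by (auto simp: eventually_at_right_field)
  have "L t < p + 1" if t: "0 < t" "t < d" for t
  proof (rule ccontr)
    assume "\<not> L t < p + 1"
    then have "integral {p..p+1} (\<lambda>x. max 0 (U t x - 1/2)) = integral {p..p+1} (\<lambda>x. 1/2)"
      using t U_left[of t] by (intro integral_cong) auto
    then show False using d(2)[OF t] by simp
  qed
  with d(1) show ?thesis using that by blast
qed

text \<open>A bump launched at an arbitrarily small time must stay ahead from then on, so the
  eventual bound is extended to all positive times: near 0, on a compact interval, and beyond
  it.\<close>

lemma L_less_linear:
  assumes "admissible U\<^sub>0" and "\<forall>\<^sub>F t in at_top. L t \<le> c * t"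
  obtains A where "\<And>t. t > 0 \<Longrightarrow> L t < A + c * t"
proof -
  obtain x\<^sub>0 d where d: "d > 0" "\<And>t. 0 < t \<Longrightarrow> t < d \<Longrightarrow> L t < x\<^sub>0"
    using L_bounded_near_0[OF assms(1)] by blast
  obtain T where T: "\<And>t. t \<ge> T \<Longrightarrow> L t \<le> c * t"
    using assms(2) by (auto simp: eventually_at_top_linorder)
  have "continuous_on {d..T} (\<lambda>t. L t - c * t)"
    using d(1) by (intro continuous_intros continuous_on_subset[OF L_cont]) auto
  then have "bdd_above ((\<lambda>t. L t - c * t) ` {d..T})"
    by (intro bounded_imp_bdd_above compact_imp_bounded compact_continuous_image) auto
  then obtain M where "\<forall>t\<in>{d..T}. L t - c * t \<le> M" by (auto simp: bdd_above_def)
  then have M: "L t - c * t \<le> M" if "d \<le> t" "t \<le> T" for t using that by simp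
  define A where "A = max (x\<^sub>0 + \<bar>c\<bar> * d) (max M 0) + 1"
  have A: "x\<^sub>0 + \<bar>c\<bar> * d < A" "M < A" "0 < A" by (auto simp: A_def)
  have "L t < A + c * t" if "t > 0" for t
  proof -
    consider "t < d" | "d \<le> t" "t \<le> T" | "t \<ge> T" by linarith
    then show ?thesis
    proof cases
      case 1
      have "- (c * t) \<le> \<bar>c * t\<bar>" by simp
      also have "\<dots> \<le> \<bar>c\<bar> * d" using 1 that by (simp add: abs_mult mult_left_mono)
      finally show ?thesis using d(2)[OF that 1] A by simp
    next
      case 2
      then show ?thesis using M[OF 2] A by simp
    next
      case 3
      then show ?thesis using T[OF 3] A by simp
    qed
  qed
  then show ?thesis using that by blast
qed

lemma initial_decay:
  assumes "admissible U\<^sub>0" and r: "0 < r" "r\<^sup>2 < 2" and "r' < r" and "0 < r'"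
    and L_less: "\<And>t. t > 0 \<Longrightarrow> L t < A + (1 / r + r / 2) * t"
  obtains B where "B > 0" "\<And>x. U\<^sub>0 x \<le> B * exp (- r' * x)"
proof -
  note U0 = admissible_facts[OF assms(1)]
  define s where "s = 1 / r - r / 2"
  have rs: "r * s = 1 - r\<^sup>2 / 2" using r by (simp add: s_def field_simps power2_eq_square)
  then have "0 < r * s" using r by simp
  then have "s > 0" using r by (simp add: zero_less_mult_iff)
  \<comment> \<open>\<open>s\<close> is the speed of the bounding line relative to the bump. An
    infinitely wide bump would grow at rate \<open>r * s\<close>; this width costs
    \<open>s * (r - r')\<close> and leaves \<open>s * r'\<close>.\<close>
  define w where "w = pi / sqrt (2 * s * (r - r'))"
  have "2 * s * (r - r') > 0" using \<open>s > 0\<close> \<open>r' < r\<close> by simp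
  then have "w > 0" and "(pi / w)\<^sup>2 = 2 * s * (r - r')" by (auto simp: w_def)
  then have \<mu>: "1 - r\<^sup>2 / 2 - (pi / w)\<^sup>2 / 2 = s * r'" using rs by (simp add: algebra_simps)
  define I where "I = integral {0..w} (bump r w)"
  have "I > 0" using bump_integral_pos[OF \<open>w > 0\<close>] by (simp add: I_def)
  have main: "U\<^sub>0 (a + w + 1) \<le> exp (- r' * (a - A))" if "a > A" for a
  proof -
    \<comment> \<open>By monotonicity \<open>m\<close> is a lower bound for \<open>U\<^sub>0\<close>
      on \<open>{a..a+w+1}\<close>. The extra unit of length contains the moving window as long as
      \<open>r * t < 1\<close>. \<open>T\<close> is the time at which the bounding line catches up
      with the bump.\<close>
    define m where "m = U\<^sub>0 (a + w + 1)"
    define T where "T = (a - A) / s"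
    have "T > 0" using that \<open>s > 0\<close> by (simp add: T_def)
    define g where "g t x = max 0 (m - U t x)" for t x
    have g_cont: "continuous_on S (g t)" if "t > 0" for t S
      unfolding g_def using that by (intro continuous_intros U_slice_cont)
    have lim: "((\<lambda>t. integral {a..a+w+1} (g t)) \<longlongrightarrow> 0) (at_right 0)"
    proof (rule initial_L1)
      show "g t x \<le> \<bar>U t x - U\<^sub>0 x\<bar>" if "x \<in> {a..a+w+1}" for t x
        using U0(3)[of x "a+w+1"] that by (auto simp: g_def m_def)
    qed (use g_cont in \<open>auto simp: g_def\<close>)
    \<comment> \<open>The bump starts at a small positive time, where its mass falls short of
      \<open>m * I\<close> by at most the weighted deficit \<open>g\<close>. The deficit disappears
      as \<open>t\<close> tends to 0.\<close>
    have "m * I - exp (r * w) * integral {a..a+w+1} (g t) \<le> I * exp (- (s * r' * (T - t)))"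
      if t: "0 < t" "t < min T (1 / r)" for t
    proof -
      have rt: "0 < r * t" "r * t < 1" using t r by (auto simp: field_simps)
      have "exp (s * r' * (T - t)) * bump_mass a r w t \<le> bump_mass a r w T"
        unfolding \<mu>[symmetric]
      proof (rule bump_mass_growth[OF \<open>w > 0\<close>])
        show "L t' < a + r * t'" if "t \<le> t'" "t' \<le> T" for t'
        proof -
          have "s * t' \<le> a - A" using that \<open>s > 0\<close> by (simp add: T_def field_simps)
          moreover have "(1 / r + r / 2) * t' = s * t' + r * t'" by (simp add: s_def algebra_simps)
          ultimately show ?thesis using L_less[of t'] that t by linarith
        qed
      qed (use t in auto)
      also have "\<dots> \<le> I" using bump_mass_le[OF \<open>T > 0\<close>] by (simp add: I_def)
      finally have "exp (- (s * r' * (T - t))) * (exp (s * r' * (T - t)) * bump_mass a r w t)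
          \<le> exp (- (s * r' * (T - t))) * I" by (intro mult_left_mono) auto
      then have upper: "bump_mass a r w t \<le> I * exp (- (s * r' * (T - t)))"
        by (simp flip: mult.assoc exp_add) (simp add: mult.commute)
      have shift_cont: "continuous_on {0..w} (\<lambda>y. g t (a + r * t + y))"
        by (rule continuous_on_compose2[OF g_cont[OF t(1), of UNIV]]) (auto intro: continuous_intros)
      have "m * I - exp (r * w) * integral {a..a+w+1} (g t) \<le>
          m * I - exp (r * w) * integral {0..w} (\<lambda>y. g t (a + r * t + y))"
      proof -
        have "integral {0..w} (\<lambda>y. g t (a + r * t + y)) = integral {a + r * t..w + (a + r * t)} (g t)"
          using integral_shift[of 0 "a + r * t" w "g t"] g_cont[OF t(1)]
          by (simp add: o_def add.commute)
        also have "\<dots> \<le> integral {a..a+w+1} (g t)"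
          using rt t by (intro integral_subset_le integrable_continuous_real g_cont) (auto simp: g_def)
        finally show ?thesis by simp
      qed
      also have "\<dots> = integral {0..w} (\<lambda>y. m * bump r w y - exp (r * w) * g t (a + r * t + y))"
        unfolding I_def
        by (subst integral_diff)
          (auto intro!: integrable_continuous_real continuous_intros bump_cont shift_cont)
      also have "\<dots> \<le> bump_mass a r w t"
        unfolding bump_mass_def
      proof (rule integral_le)
        fix y assume y: "y \<in> {0..w}"
        have "bump r w y \<le> exp (r * y) * 1"
          unfolding bump_def by (intro mult_left_mono) auto
        also have "\<dots> \<le> exp (r * w)" using y r by simp
        finally have "bump r w y \<le> exp (r * w)" .
        then have "bump r w y * g t (a + r * t + y) \<le> exp (r * w) * g t (a + r * t + y)"
          by (intro mult_right_mono) (auto simp: g_def)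
        moreover have "bump r w y * (m - U t (a + r * t + y)) \<le> bump r w y * g t (a + r * t + y)"
          using y bump_nonneg[of y w r] by (intro mult_left_mono) (auto simp: g_def)
        ultimately show "m * bump r w y - exp (r * w) * g t (a + r * t + y)
            \<le> U t (a + r * t + y) * bump r w y"
          by (simp add: algebra_simps)
      qed (use t in \<open>auto intro!: integrable_continuous_real continuous_intros bump_cont
              shift_cont U_shift_cont\<close>)
      finally show ?thesis using upper by simp
    qed
    then have ev: "\<forall>\<^sub>F t in at_right 0. m * I - exp (r * w) * integral {a..a+w+1} (g t)
        \<le> I * exp (- (s * r' * (T - t)))"
      using \<open>T > 0\<close> r by (intro eventually_at_rightI[of 0 "min T (1 / r)"]) auto
    have "m * I - exp (r * w) * 0 \<le> I * exp (- (s * r' * (T - 0)))"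
      by (rule tendsto_le[OF trivial_limit_at_right_real _ _ ev])
        (intro tendsto_intros lim)+
    then have "I * m \<le> I * exp (- (s * r' * T))" by (simp add: mult.commute)
    then have "m \<le> exp (- (s * r' * T))" using \<open>I > 0\<close> by simp
    also have "s * r' * T = r' * (a - A)" using \<open>s > 0\<close> by (simp add: T_def)
    finally show ?thesis by (simp add: m_def)
  qed
  have "U\<^sub>0 x \<le> exp (r' * (A + w + 1)) * exp (- r' * x)" for x
  proof (cases "x > A + w + 1")
    case True
    then show ?thesis using main[of "x - w - 1"] by (simp flip: exp_add add: algebra_simps)
  next
    case False
    then have "r' * x \<le> r' * (A + w + 1)" using \<open>0 < r'\<close> by (intro mult_left_mono) auto
    then have "1 \<le> exp (r' * (A + w + 1)) * exp (- r' * x)" by (simp flip: exp_add)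
    then show ?thesis using U0(2)[of x] by simp
  qed
  then show ?thesis using that[of "exp (r' * (A + w + 1))"] by simp
qed

text \<open>If it held, \<open>L t - c * t\<close> would attain its maximum over
  \<open>t \<ge> 1\<close> at some \<open>T\<close>, so the boundary would stay behind a line of
  speed \<open>c\<close> from \<open>T\<close> on. A bump just ahead of that line would then grow
  without bound.\<close>

lemma L_not_slower:
  assumes "c\<^sup>2 < 2" "c' < c"
  shows "\<not> (\<forall>\<^sub>F t in at_top. L t \<le> c' * t)"
proof
  assume "\<forall>\<^sub>F t in at_top. L t \<le> c' * t"
  then obtain T\<^sub>0 where T0: "\<And>t. t \<ge> T\<^sub>0 \<Longrightarrow> L t \<le> c' * t"
    by (auto simp: eventually_at_top_linorder)
  \<comment> \<open>After this time \<open>L t - c * t\<close> is below its value at time 1, so the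
    maximum over \<open>{1..T\<^sub>1}\<close> is global on \<open>t \<ge> 1\<close>.\<close>
  define T\<^sub>1 where "T\<^sub>1 = max 1 (max T\<^sub>0 ((c - L 1) / (c - c')))"
  have late: "L t - c * t \<le> L 1 - c * 1" if "t \<ge> T\<^sub>1" for t
  proof -
    have "(c - L 1) / (c - c') \<le> t" "T\<^sub>0 \<le> t" using that by (auto simp: T\<^sub>1_def)
    then have "c - L 1 \<le> (c - c') * t" using \<open>c' < c\<close> by (simp add: field_simps)
    then show ?thesis using T0[OF \<open>T\<^sub>0 \<le> t\<close>] by (simp add: algebra_simps)
  qed
  have "continuous_on {1..T\<^sub>1} (\<lambda>t. L t - c * t)"
    by (intro continuous_intros continuous_on_subset[OF L_cont]) auto
  moreover have "{1..T\<^sub>1} \<noteq> {}" by (auto simp: T\<^sub>1_def)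
  ultimately obtain T where T: "T \<in> {1..T\<^sub>1}"
    and max: "\<And>t. t \<in> {1..T\<^sub>1} \<Longrightarrow> L t - c * t \<le> L T - c * T"
    using continuous_attains_sup[of "{1..T\<^sub>1}" "\<lambda>t. L t - c * t"] by auto
  have "T > 0" using T by simp
  have L_le: "L t - c * t \<le> L T - c * T" if "t \<ge> T" for t
    using max[of t] max[of 1] late[of t] T that by (cases "t \<le> T\<^sub>1") auto
  \<comment> \<open>Positivity of the initial mass comes from continuity at \<open>L T\<close>,
    where \<open>U\<close> is 1. The window starts \<open>\<delta> / 2\<close> ahead, strictly
    beyond the boundary yet still inside the region of positivity.\<close>
  have "isCont (U T) (L T)"
    using U_slice_cont[OF \<open>T > 0\<close>, of UNIV] by (simp add: continuous_on_eq_continuous_at)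
  then have "\<forall>\<^sub>F x in at (L T). U T x > 0"
    using U_left[OF \<open>T > 0\<close>, of "L T"] by (auto simp: isCont_def intro: order_tendstoD)
  then obtain \<delta> where \<delta>: "\<delta> > 0" "\<And>x. x \<noteq> L T \<Longrightarrow> dist x (L T) < \<delta> \<Longrightarrow> U T x > 0"
    by (auto simp: eventually_at)
  define a where "a = L T + \<delta> / 2 - c * T"
  \<comment> \<open>This width halves the limiting rate \<open>1 - c\<^sup>2 / 2\<close>, so \<mu>
    remains positive.\<close>
  define w where "w = pi / sqrt (1 - c\<^sup>2 / 2)"
  define \<mu> where "\<mu> = 1 - c\<^sup>2 / 2 - (pi / w)\<^sup>2 / 2"
  have "1 - c\<^sup>2 / 2 > 0" using \<open>c\<^sup>2 < 2\<close> by simp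
  then have "w > 0" "(pi / w)\<^sup>2 = 1 - c\<^sup>2 / 2" by (auto simp: w_def)
  with \<open>c\<^sup>2 < 2\<close> have "\<mu> > 0" by (simp add: \<mu>_def)
  define K where "K = bump_mass a c w T"
  define I where "I = integral {0..w} (bump c w)"
  have "I > 0" using bump_integral_pos[OF \<open>w > 0\<close>] by (simp add: I_def)
  have "K > 0"
  proof -
    let ?f = "\<lambda>y. U T (a + c * T + y) * bump c w y"
    have cont: "continuous_on {0..w} ?f"
      using \<open>T > 0\<close> by (intro continuous_on_mult U_shift_cont bump_cont)
    have nonneg: "0 \<le> ?f y" if "y \<in> {0..w}" for y
      using that bump_nonneg[of y w c] U_range(1)[OF \<open>T > 0\<close>] by auto
    define y where "y = min (w / 2) (\<delta> / 4)"
    have y: "0 < y" "y < w" "y \<le> \<delta> / 4" using \<open>w > 0\<close> \<open>\<delta> > 0\<close> by (auto simp: y_def)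
    have "?f y > 0"
      using y bump_pos[of y w c] \<delta> by (intro mult_pos_pos \<delta>(2)) (auto simp: a_def dist_real_def)
    then have "K \<noteq> 0"
      using integral_eq_0_iff[OF cont \<open>w > 0\<close> nonneg] y unfolding K_def bump_mass_def by fastforce
    moreover have "K \<ge> 0"
      unfolding K_def bump_mass_def using nonneg cont
      by (intro integral_nonneg integrable_continuous_real) auto
    ultimately show ?thesis by simp
  qed
  \<comment> \<open>Chosen so that already the linear lower bound of the exponential pushes the mass
    to \<open>K + I\<close>, above its cap \<open>I\<close>.\<close>
  define t where "t = T + I / (K * \<mu>)"
  have "T \<le> t" using \<open>I > 0\<close> \<open>K > 0\<close> \<open>\<mu> > 0\<close> by (simp add: t_def)
  have "exp (\<mu> * (t - T)) * K \<le> bump_mass a c w t"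
    unfolding K_def \<mu>_def
    by (rule bump_mass_growth) (use \<open>w > 0\<close> \<open>T > 0\<close> \<open>T \<le> t\<close> L_le \<delta>(1) in \<open>force simp: a_def\<close>)+
  also have "\<dots> \<le> I" using bump_mass_le[of t a c w] \<open>T > 0\<close> \<open>T \<le> t\<close> by (simp add: I_def)
  finally have "exp (\<mu> * (t - T)) * K \<le> I" .
  moreover have "(1 + \<mu> * (t - T)) * K \<le> exp (\<mu> * (t - T)) * K"
    using \<open>K > 0\<close> exp_ge_add_one_self by (intro mult_right_mono) auto
  moreover have "(1 + \<mu> * (t - T)) * K = K + I"
    using \<open>K > 0\<close> \<open>\<mu> > 0\<close> by (simp add: t_def field_simps)
  ultimately show False using \<open>K > 0\<close> by simp
qed

end

section \<open>The speed of the free boundary\<close>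

abbreviation (input) speed :: "real \<Rightarrow> real" where "speed r \<equiv> 1 / r + r / 2"

text \<open>The difference of the speeds is
  \<open>(r - \<rho>) * (2 - \<rho> * r) / (2 * \<rho> * r)\<close>, whose sign is controlled by
  \<open>\<rho> * r \<le> 2\<close>.\<close>

lemma speed_antimono:
  assumes "0 < \<rho>" "\<rho> \<le> r" "r < sqrt 2" shows "speed r \<le> speed \<rho>"
proof -
  have "\<rho> * r \<le> sqrt 2 * sqrt 2" using assms by (intro mult_mono) auto
  then have "0 \<le> (r - \<rho>) * (2 - \<rho> * r)" using assms by simp
  also have "(r - \<rho>) * (2 - \<rho> * r) = 2 * \<rho> * r * (speed \<rho> - speed r)"
    using assms by (simp add: field_simps)
  finally have "0 \<le> 2 * \<rho> * r * (speed \<rho> - speed r)" .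
  moreover have "0 < 2 * \<rho> * r" using assms by simp
  ultimately show ?thesis
    using zero_le_mult_iff[of "2 * \<rho> * r" "speed \<rho> - speed r"] by linarith
qed

lemma tendsto_speed: "r \<noteq> 0 \<Longrightarrow> (speed \<longlongrightarrow> speed r) (at r within A)"
  by (intro tendsto_intros) auto

context fbp_solution begin

lemma Limsup_le_speed:
  assumes "admissible U\<^sub>0" "0 < r" "(\<integral>\<^sup>+x\<in>{0..}. ennreal (exp (r * x) * U\<^sub>0 x) \<partial>lborel) < \<infinity>"
  shows "Limsup at_top (\<lambda>t. ereal (1 / t * L t)) \<le> ereal (speed r)"
proof -
  obtain B where B: "B > 0" "\<And>x. U\<^sub>0 x \<le> B * exp (- r * x)"
    using exp_moment_imp_decay[OF assms] by blast
  have "\<forall>\<^sub>F t in at_top. ereal (1 / t * L t) \<le> ereal (speed r + (ln B / r) / t)"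
    using eventually_gt_at_top[of 0]
  proof eventually_elim
    case (elim t)
    have "1 / t * L t \<le> 1 / t * (speed r * t + ln B / r)"
      using L_le_linear[OF \<open>0 < r\<close> B(2) B(1) elim] elim by (intro mult_left_mono) auto
    also have "\<dots> = speed r + (ln B / r) / t" using elim by (simp add: distrib_left)
    finally show ?case by simp
  qed
  then have "Limsup at_top (\<lambda>t. ereal (1 / t * L t))
      \<le> Limsup at_top (\<lambda>t. ereal (speed r + (ln B / r) / t))"
    by (rule Limsup_mono)
  also have "\<dots> = ereal (speed r + 0)"
  proof (intro lim_imp_Limsup tendsto_ereal tendsto_add tendsto_const)
    show "((\<lambda>t. ln B / r / t) \<longlongrightarrow> 0) at_top"
      by (rule tendsto_divide_0[OF tendsto_const])
        (simp add: filterlim_at_top_imp_at_infinity[OF filterlim_ident])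
  qed simp
  finally show ?thesis by simp
qed

lemma Limsup_less_imp:
  assumes "Limsup at_top (\<lambda>t. ereal (1 / t * L t)) < ereal c"
  shows "\<forall>\<^sub>F t in at_top. L t \<le> c * t"
  using Limsup_lessD[OF assms] eventually_gt_at_top[of 0]
proof eventually_elim
  case (elim t)
  then show ?case by (simp add: field_simps)
qed

end

theorem theorem1p10:
  fixes U\<^sub>0 :: "real \<Rightarrow> real" and U :: "real \<Rightarrow> real \<Rightarrow> real" and L :: "real \<Rightarrow> real"
    and r\<^sub>0 :: real
  assumes "admissible U\<^sub>0"
    and "classical_solution U\<^sub>0 U L"
    and "r\<^sub>0 = decay_rate U\<^sub>0"
  shows "Limsup at_top (\<lambda>t. ereal (1 / t * L t)) =
           (if r\<^sub>0 > 0 then ereal (1 / r\<^sub>0 + r\<^sub>0 / 2) else \<infinity>)"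
proof -
  interpret fbp_solution U\<^sub>0 U L using assms(2) by unfold_locales
  define S where "S = {r. 0 < r \<and> r < sqrt 2 \<and>
    (\<integral>\<^sup>+x\<in>{0..}. ennreal (exp (r * x) * U\<^sub>0 x) \<partial>lborel) < \<infinity>}"
  have r0: "r\<^sub>0 = Sup ({0} \<union> S)" using assms(3) by (simp add: decay_rate_def S_def)
  have bdd: "bdd_above ({0} \<union> S)" by (rule bdd_aboveI[of _ "sqrt 2"]) (auto simp: S_def)
  have le_r0: "r \<le> r\<^sub>0" if "r \<in> S" for r
    unfolding r0 using that bdd by (intro cSup_upper) auto
  have "0 \<le> r\<^sub>0" unfolding r0 using bdd by (intro cSup_upper) auto
  have r0_le: "r\<^sub>0 \<le> sqrt 2" unfolding r0 by (rule cSup_least) (auto simp: S_def)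
  define l where "l = Limsup at_top (\<lambda>t. ereal (1 / t * L t))"
  define target where "target = (if r\<^sub>0 > 0 then ereal (speed r\<^sub>0) else \<infinity>)"
  have "l \<le> target"
  proof (cases "r\<^sub>0 > 0")
    case True
    \<comment> \<open>The supremum may not be attained, so the bound is proved below
      \<open>r\<^sub>0\<close> and passed to the limit by continuity of
      \<open>speed\<close>.\<close>
    have "l \<le> ereal (speed \<rho>)" if \<rho>: "0 < \<rho>" "\<rho> < r\<^sub>0" for \<rho>
    proof -
      obtain r where "r \<in> {0} \<union> S" "\<rho> < r"
        using \<rho>(2) less_cSup_iff[OF _ bdd] unfolding r0 by auto
      then have "r \<in> S" using \<rho> by auto
      then have "l \<le> ereal (speed r)"
        unfolding l_def using assms(1) by (intro Limsup_le_speed) (auto simp: S_def)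
      also have "\<dots> \<le> ereal (speed \<rho>)"
        using speed_antimono[of \<rho> r] \<rho> \<open>\<rho> < r\<close> \<open>r \<in> S\<close> by (simp add: S_def)
      finally show ?thesis .
    qed
    then have "\<forall>\<^sub>F \<rho> in at_left r\<^sub>0. l \<le> ereal (speed \<rho>)"
      using True by (intro eventually_at_leftI[of 0]) auto
    moreover have "((\<lambda>\<rho>. ereal (speed \<rho>)) \<longlongrightarrow> ereal (speed r\<^sub>0)) (at_left r\<^sub>0)"
      using True by (intro tendsto_ereal tendsto_speed) auto
    ultimately have "l \<le> ereal (speed r\<^sub>0)"
      by (intro tendsto_lowerbound[of _ _ "at_left r\<^sub>0"]) auto
    then show ?thesis using True by (simp add: target_def)
  qed (simp add: target_def)
  moreover have "\<not> l < target"
  proof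
    assume less: "l < target"
    show False
    proof (cases "r\<^sub>0 = sqrt 2")
      case True
      \<comment> \<open>No exponent between \<open>r\<^sub>0\<close> and \<open>sqrt 2\<close> is
        left to contradict the supremum; instead the target is itself \<open>sqrt 2\<close>, and
        \<open>L_not_slower\<close> excludes any smaller speed.\<close>
      have "speed (sqrt 2) = sqrt 2" by (simp add: field_simps)
      then have "l < ereal (sqrt 2)" using less True by (simp add: target_def)
      then obtain c' where c': "l < ereal c'" "c' < sqrt 2"
        using ereal_dense2[of l "ereal (sqrt 2)"] by auto
      \<comment> \<open>The maximum with 0 makes \<open>c\<close> nonnegative, so that
        \<open>c < sqrt 2\<close> can be squared.\<close>
      define c where "c = (max c' 0 + sqrt 2) / 2"
      have c: "c' < c" "0 \<le> c" "c < sqrt 2" using c'(2) by (auto simp: c_def max_def)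
      then have "c\<^sup>2 < (sqrt 2)\<^sup>2" by (intro power_strict_mono) auto
      then show False using L_not_slower[of c c'] Limsup_less_imp[of c'] c c' by (simp add: l_def)
    next
      case False
      then have "r\<^sub>0 < sqrt 2" using r0_le by simp
      \<comment> \<open>The strict gap survives for exponents slightly above
        \<open>r\<^sub>0\<close>: by continuity if \<open>r\<^sub>0 > 0\<close>, and by the blow-up
        of \<open>1 / r\<close> at 0 otherwise.\<close>
      have "\<forall>\<^sub>F r in at_right r\<^sub>0. l < ereal (speed r)"
      proof (cases "r\<^sub>0 > 0")
        case True
        then have "((\<lambda>r. ereal (speed r)) \<longlongrightarrow> ereal (speed r\<^sub>0)) (at_right r\<^sub>0)"
          by (intro tendsto_ereal tendsto_speed) auto
        then show ?thesis by (rule order_tendstoD) (use less True in \<open>simp add: target_def\<close>)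
      next
        case False
        then have "r\<^sub>0 = 0" using \<open>0 \<le> r\<^sub>0\<close> by simp
        obtain M where M: "l < ereal M" 
          using less False ereal_dense2[of l \<infinity>] by (auto simp: target_def)
        have "\<forall>\<^sub>F r in at_right (0::real). M \<le> inverse r"
          using filterlim_inverse_at_top_right by (simp add: filterlim_at_top)
        then have "\<forall>\<^sub>F r in at_right 0. l < ereal (speed r)"
          using eventually_at_right_less[of 0]
        proof eventually_elim
          case (elim r)
          then have "ereal M \<le> ereal (speed r)" by (simp add: inverse_eq_divide)
          with M show ?case by (rule less_le_trans)
        qed
        with \<open>r\<^sub>0 = 0\<close> show ?thesis by simp
      qed
      moreover have "\<forall>\<^sub>F r in at_right r\<^sub>0. r \<in> {r\<^sub>0<..<sqrt 2}"
        using \<open>r\<^sub>0 < sqrt 2\<close> by (rule eventually_at_right_real)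
      ultimately have "\<forall>\<^sub>F r in at_right r\<^sub>0. l < ereal (speed r) \<and> r \<in> {r\<^sub>0<..<sqrt 2}"
        by (rule eventually_conj)
      from eventually_happens'[OF trivial_limit_at_right_real this]
      obtain r where r: "l < ereal (speed r)" "r\<^sub>0 < r" "r < sqrt 2" by auto
      have "0 < r" using r \<open>0 \<le> r\<^sub>0\<close> by simp
      have "r\<^sup>2 < (sqrt 2)\<^sup>2" using r \<open>0 < r\<close> by (intro power_strict_mono) auto
      \<comment> \<open>Two losses are paid for: from \<open>r\<close> to \<open>r'\<close> for the
        finite width of the bump, from \<open>r'\<close> to \<open>r''\<close> for convergence of
        the moment. The result still exceeds \<open>r\<^sub>0\<close>.\<close>
      obtain r' where r': "r\<^sub>0 < r'" "r' < r" using dense r(2) by blast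
      obtain r'' where r'': "r\<^sub>0 < r''" "r'' < r'" using dense r'(1) by blast
      obtain A where A: "\<And>t. t > 0 \<Longrightarrow> L t < A + speed r * t"
        using L_less_linear[OF assms(1) Limsup_less_imp[of "speed r"]] r(1) unfolding l_def by blast
      obtain B where "B > 0" "\<And>x. U\<^sub>0 x \<le> B * exp (- r' * x)"
        using initial_decay[OF assms(1) \<open>0 < r\<close> _ r'(2) _ A] \<open>r\<^sup>2 < (sqrt 2)\<^sup>2\<close> r' \<open>0 \<le> r\<^sub>0\<close> by auto
      then have "r'' \<in> S"
        using decay_imp_exp_moment[OF assms(1) r''(2)] r r' r'' \<open>0 \<le> r\<^sub>0\<close> by (simp add: S_def)
      then show False using le_r0[of r''] r'' by simp
    qed
  qed
  ultimately have "l = target" by simp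
  then show ?thesis by (simp add: l_def target_def)
qed

end
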